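(* Let $H$ and $K$ be complex infinite-dimensional separable Hilbert spaces, and let $A\in B(H)$ and $B\in B(K)$ be given. For $C\in B(K,H)$ let $M_C=\begin{pmatrix}A&C\\0&B\end{pmatrix}\in B(H\oplus K)$. Then $$\bigcap_{C\in G(K,H)}\sigma_b(M_C)=\bigcap_{C\in\Phi(K,H)}\sigma_b(M_C)=\sigma_{lb}(A)\cup\sigma_{rb}(B)\cup\{\lambda\in\mathbb{C}:\alpha(A-\lambda)+\alpha(B-\lambda)\neq\beta(A-\lambda)+\beta(B-\lambda)\}.$$
   Context: $B(K,H)$ is the set of bounded linear operators from $K$ to $H$, and $B(H)=B(H,H)$. $G(K,H)$ is the set of invertible operators in $B(K,H)$, and $\Phi(K,H)$ is the set of Fredholm operators in $B(K,H)$, i.e. those $T$ with $\alpha(T)<\infty$ and $\beta(T)<\infty$. Here, for a bounded operator $T$ from $Z$ to $W$ with kernel $N(T)$ and range $R(T)$, $\alpha(T)=\dim N(T)$ and $\beta(T)=\dim W/R(T)$, with values in $\{0,1,2,\dots\}\cup\{\infty\}$ (all infinite dimensions are recorded as $\infty$). For $T\in B(Z)$: $asc(T)=\inf\{k\ge 0:N(T^k)=N(T^{k+1})\}$ and $des(T)=\inf\{k\ge 0:R(T^k)=R(T^{k+1})\}$ (equal to $\infty$ if no such $k$ exists). $T$ is Browder if it is Fredholm and $asc(T)=des(T)<\infty$. $T$ is left semi-Fredholm if $R(T)$ is a closed and complemented subspace of $Z$ and $\alpha(T)<\infty$; $T$ is right semi-Fredholm if $N(T)$ is a closed and complemented subspace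 of $Z$ and $\beta(T)<\infty$. $T$ is left semi-Browder if it is left semi-Fredholm and $asc(T)<\infty$; $T$ is right semi-Browder if it is right semi-Fredholm and $des(T)<\infty$. The Browder spectrum $\sigma_b(T)$, left semi-Browder spectrum $\sigma_{lb}(T)$ and right semi-Browder spectrum $\sigma_{rb}(T)$ are the sets of $\lambda\in\mathbb{C}$ for which $T-\lambda$ is not Browder, not left semi-Browder, and not right semi-Browder, respectively. *)

theory Defs
  imports "HOL-Analysis.Analysis"
begin

section \<open>Complex Hilbert spaces\<close>

class complex_vector = real_vector +
  fixes scaleC :: "complex \<Rightarrow> 'a \<Rightarrow> 'a"  (infixr "*\<^sub>C" 75)
  assumes scaleC_add_right: "a *\<^sub>C (x + y) = a *\<^sub>C x + a *\<^sub>C y"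
    and scaleC_add_left: "(a + b) *\<^sub>C x = a *\<^sub>C x + b *\<^sub>C x"
    and scaleC_scaleC: "a *\<^sub>C b *\<^sub>C x = (a * b) *\<^sub>C x"
    and scaleC_one: "1 *\<^sub>C x = x"
    and scaleR_scaleC: "r *\<^sub>R x = complex_of_real r *\<^sub>C x"

interpretation complex_vector: vector_space "scaleC :: complex \<Rightarrow> 'a \<Rightarrow> 'a::complex_vector"
  by unfold_locales
    (simp_all add: scaleC_add_right scaleC_add_left scaleC_scaleC scaleC_one)

text \<open>
  The complex inner product is linear in its first argument. Its definiteness and its relation
  to the norm come from the underlying real inner product, which is its real part:
  \<open>cinner x x\<close> is real by conjugate symmetry, so it equals \<open>inner x x = (norm x)\<^sup>2\<close>.
\<close>

class complex_inner = complex_vector + real_inner +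
  fixes cinner :: "'a \<Rightarrow> 'a \<Rightarrow> complex"
  assumes cinner_commute: "cinner x y = cnj (cinner y x)"
    and cinner_add_left: "cinner (x + y) z = cinner x z + cinner y z"
    and cinner_scaleC_left: "cinner (a *\<^sub>C x) y = a * cinner x y"
    and inner_eq_Re_cinner: "inner x y = Re (cinner x y)"

class chilbert_space = complex_inner + complete_space

text \<open>
  The Hilbert space direct sum is the product type, whose real inner product is
  the library's \<open>inner x y = inner (fst x) (fst y) + inner (snd x) (snd y)\<close>.
\<close>

instantiation prod :: (complex_vector, complex_vector) complex_vector
begin

definition scaleC_prod_def: "a *\<^sub>C x = (a *\<^sub>C fst x, a *\<^sub>C snd x)"

instance
  by standard
    (simp_all add: scaleC_prod_def scaleR_prod_def scaleC_add_right scaleC_add_left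
      scaleC_scaleC scaleC_one scaleR_scaleC)

end

instantiation prod :: (complex_inner, complex_inner) complex_inner
begin

definition cinner_prod_def: "cinner x y = cinner (fst x) (fst y) + cinner (snd x) (snd y)"

instance
proof
  fix x y z :: "'a \<times> 'b" and a :: complex
  show "cinner x y = cnj (cinner y x)"
    by (simp add: cinner_prod_def cinner_commute[of "fst x"] cinner_commute[of "snd x"])
  show "cinner (x + y) z = cinner x z + cinner y z"
    by (simp add: cinner_prod_def cinner_add_left)
  show "cinner (a *\<^sub>C x) y = a * cinner x y"
    by (simp add: cinner_prod_def scaleC_prod_def cinner_scaleC_left distrib_left)
  show "inner x y = Re (cinner x y)"
    by (simp add: cinner_prod_def inner_prod_def inner_eq_Re_cinner)
qed

end

instance prod :: (chilbert_space, chilbert_space) chilbert_space ..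

definition separable :: "'a::topological_space set \<Rightarrow> bool" where
  "separable S \<longleftrightarrow> (\<exists>D. countable D \<and> D \<subseteq> S \<and> S \<subseteq> closure D)"


section \<open>Dimension and codimension\<close>

text \<open>Dimension of a complex linear subspace; all infinite dimensions are \<open>\<infinity>\<close>.\<close>

definition cdimension :: "'a::complex_vector set \<Rightarrow> enat" where
  "cdimension V =
    (if \<exists>B. finite B \<and> complex_vector.span B = V then enat (complex_vector.dim V) else \<infinity>)"

text \<open>
  \<open>quotient_basis V B\<close>: the cosets \<open>b + V\<close> for \<open>b \<in> B\<close> are pairwise distinct and form a basis
  of the quotient of the whole space by \<open>V\<close>. A linear combination of cosets is zero in the
  quotient iff the same combination of representatives lies in \<open>V\<close>.
\<close>

definition quotient_basis :: "'a::complex_vector set \<Rightarrow> 'a set \<Rightarrow> bool" where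
  "quotient_basis V B \<longleftrightarrow>
    (\<forall>F u. finite F \<and> F \<subseteq> B \<and> (\<Sum>b\<in>F. u b *\<^sub>C b) \<in> V \<longrightarrow> (\<forall>b\<in>F. u b = 0)) \<and>
    (\<forall>x. \<exists>y\<in>complex_vector.span B. x - y \<in> V)"

definition codimension :: "'a::complex_vector set \<Rightarrow> enat" where
  "codimension V =
    (if \<exists>B. finite B \<and> quotient_basis V B
     then enat (card (SOME B. finite B \<and> quotient_basis V B)) else \<infinity>)"

text \<open>The choice of the basis in \<open>codimension\<close> is immaterial.\<close>

lemma quotient_basis_card_le:
  assumes V: "complex_vector.subspace V"
    and B: "finite B" "quotient_basis V B" and C: "finite C" "quotient_basis V C"
  shows "card B \<le> card C"
proof -
  have "\<forall>x. \<exists>y\<in>complex_vector.span C. x - y \<in> V"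
    using C(2) by (simp add: quotient_basis_def)
  then obtain g where g: "\<And>x. g x \<in> complex_vector.span C" "\<And>x. x - g x \<in> V"
    by metis
  have zero: "\<forall>b\<in>B. u b = 0" if "(\<Sum>b\<in>B. u b *\<^sub>C g b) = 0" for u
  proof -
    have "(\<Sum>b\<in>B. u b *\<^sub>C (b - g b)) \<in> V"
      by (intro complex_vector.subspace_sum complex_vector.subspace_scale V g)
    then have "(\<Sum>b\<in>B. u b *\<^sub>C b) \<in> V"
      using that by (simp add: complex_vector.scale_right_diff_distrib sum_subtractf)
    then show ?thesis
      using B unfolding quotient_basis_def by blast
  qed
  have inj: "inj_on g B"
  proof (rule inj_onI, rule ccontr)
    fix b c assume bc: "b \<in> B" "c \<in> B" "g b = g c" "b \<noteq> c"
    define u :: "'a \<Rightarrow> complex" where "u = (\<lambda>x. (if x = b then 1 else 0) - (if x = c then 1 else 0))"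
    have "(\<Sum>x\<in>B. u x *\<^sub>C g x) =
        (\<Sum>x\<in>B. if x = b then g x else 0) - (\<Sum>x\<in>B. if x = c then g x else 0)"
      by (subst sum_subtractf[symmetric], rule sum.cong)
        (simp_all add: u_def complex_vector.scale_left_diff_distrib)
    also have "\<dots> = g b - g c"
      using bc(1,2) B(1) by simp
    also have "\<dots> = 0"
      using bc(3) by simp
    finally have "u b = 0"
      using zero bc by blast
    then show False
      using bc(4) by (simp add: u_def)
  qed
  have "complex_vector.independent (g ` B)"
  proof (rule complex_vector.independent_if_scalars_zero)
    fix f x assume "(\<Sum>x\<in>g ` B. f x *\<^sub>C x) = 0" "x \<in> g ` B"
    then show "f x = 0"
      using zero[of "f \<circ> g"] inj by (auto simp: sum.reindex)
  qed (simp add: B)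
  then have "card (g ` B) \<le> card C"
    using complex_vector.independent_span_bound[OF C(1)] g by blast
  then show ?thesis
    using inj by (simp add: card_image)
qed

lemma codimension_eq:
  assumes "complex_vector.subspace V" "finite B" "quotient_basis V B"
  shows "codimension V = enat (card B)"
proof -
  have "finite (SOME B. finite B \<and> quotient_basis V B) \<and>
      quotient_basis V (SOME B. finite B \<and> quotient_basis V B)"
    using assms by (intro someI[of "\<lambda>B. finite B \<and> quotient_basis V B"]) simp
  then have "card (SOME B. finite B \<and> quotient_basis V B) = card B"
    using assms by (meson le_antisym quotient_basis_card_le)
  then show ?thesis
    using assms unfolding codimension_def by auto
qed


section \<open>Operators\<close>

definition bounded_ops :: "('a::complex_inner \<Rightarrow> 'b::complex_inner) set" where
  "bounded_ops = {T. bounded_linear T \<and> (\<forall>c x. T (c *\<^sub>C x) = c *\<^sub>C T x)}"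

definition invertible_ops :: "('a::complex_inner \<Rightarrow> 'b::complex_inner) set" where
  "invertible_ops = {T \<in> bounded_ops. \<exists>S\<in>bounded_ops. S \<circ> T = id \<and> T \<circ> S = id}"

definition ker :: "('a \<Rightarrow> 'b::zero) \<Rightarrow> 'a set" where
  "ker T = {x. T x = 0}"

definition nullity :: "('a::complex_vector \<Rightarrow> 'b::zero) \<Rightarrow> enat" where
  "nullity T = cdimension (ker T)"

definition defect :: "('a \<Rightarrow> 'b::complex_vector) \<Rightarrow> enat" where
  "defect T = codimension (range T)"

definition fredholm_ops :: "('a::complex_inner \<Rightarrow> 'b::complex_inner) set" where
  "fredholm_ops = {T \<in> bounded_ops. nullity T < \<infinity> \<and> defect T < \<infinity>}"

text \<open>The infimum of the empty set in \<open>enat\<close> is \<open>\<infinity>\<close>.\<close>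

definition asc :: "('a::zero \<Rightarrow> 'a) \<Rightarrow> enat" where
  "asc T = Inf {enat k |k. ker (T ^^ k) = ker (T ^^ (k + 1))}"

definition des :: "('a \<Rightarrow> 'a) \<Rightarrow> enat" where
  "des T = Inf {enat k |k. range (T ^^ k) = range (T ^^ (k + 1))}"

definition complemented :: "'a::complex_inner set \<Rightarrow> bool" where
  "complemented V \<longleftrightarrow>
    (\<exists>W. complex_vector.subspace W \<and> closed W \<and> V \<inter> W = {0} \<and> {v + w |v w. v \<in> V \<and> w \<in> W} = UNIV)"

definition browder :: "('a::complex_inner \<Rightarrow> 'a) \<Rightarrow> bool" where
  "browder T \<longleftrightarrow> T \<in> fredholm_ops \<and> asc T = des T \<and> des T < \<infinity>"

definition left_semi_fredholm :: "('a::complex_inner \<Rightarrow> 'a) \<Rightarrow> bool" where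
  "left_semi_fredholm T \<longleftrightarrow>
    T \<in> bounded_ops \<and> closed (range T) \<and> complemented (range T) \<and> nullity T < \<infinity>"

definition right_semi_fredholm :: "('a::complex_inner \<Rightarrow> 'a) \<Rightarrow> bool" where
  "right_semi_fredholm T \<longleftrightarrow>
    T \<in> bounded_ops \<and> closed (ker T) \<and> complemented (ker T) \<and> defect T < \<infinity>"

definition left_semi_browder :: "('a::complex_inner \<Rightarrow> 'a) \<Rightarrow> bool" where
  "left_semi_browder T \<longleftrightarrow> left_semi_fredholm T \<and> asc T < \<infinity>"

definition right_semi_browder :: "('a::complex_inner \<Rightarrow> 'a) \<Rightarrow> bool" where
  "right_semi_browder T \<longleftrightarrow> right_semi_fredholm T \<and> des T < \<infinity>"

definition shift_op :: "('a::complex_vector \<Rightarrow> 'a) \<Rightarrow> complex \<Rightarrow> 'a \<Rightarrow> 'a" where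
  "shift_op T l = (\<lambda>x. T x - l *\<^sub>C x)"

definition browder_spectrum :: "('a::complex_inner \<Rightarrow> 'a) \<Rightarrow> complex set" where
  "browder_spectrum T = {l. \<not> browder (shift_op T l)}"

definition left_semi_browder_spectrum :: "('a::complex_inner \<Rightarrow> 'a) \<Rightarrow> complex set" where
  "left_semi_browder_spectrum T = {l. \<not> left_semi_browder (shift_op T l)}"

definition right_semi_browder_spectrum :: "('a::complex_inner \<Rightarrow> 'a) \<Rightarrow> complex set" where
  "right_semi_browder_spectrum T = {l. \<not> right_semi_browder (shift_op T l)}"

text \<open>The operator given by the upper triangular block matrix with rows \<open>(A, C)\<close> and \<open>(0, B)\<close>.\<close>

definition block_op ::
    "('h::plus \<Rightarrow> 'h) \<Rightarrow> ('k \<Rightarrow> 'k) \<Rightarrow> ('k \<Rightarrow> 'h) \<Rightarrow> 'h \<times> 'k \<Rightarrow> 'h \<times> 'k" where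
  "block_op A B C = (\<lambda>(x, y). (A x + C y, B y))"

end

theory Submission
  imports Defs
begin

text \<open>
  Every dimension count reduces to one statement about a composition \<open>S \<circ> T\<close> of linear maps: with
  \<open>a = dim (R(T) \<inter> N(S))\<close> and \<open>c = codim (R(T) + N(S))\<close> there is \<open>b\<close> such that
  \<open>\<alpha>(S T) = \<alpha>(T) + a\<close>, \<open>\<beta>(S T) = \<beta>(S) + c\<close>, \<open>\<alpha>(S) = a + b\<close> and \<open>\<beta>(T) = b + c\<close>.

  If \<open>M\<^sub>C\<close> is Browder then \<open>\<alpha>(M\<^sub>C) = \<beta>(M\<^sub>C)\<close>, and \<open>M\<^sub>C\<close> is the composition of
  \<open>(x, y) \<mapsto> (A x, y)\<close> with \<open>(x, y) \<mapsto> (x + C y, B y)\<close>, which gives the index equation. The range of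
  \<open>A\<close> is closed because \<open>R(A) \<times> 0\<close> is the image under \<open>M\<^sub>C\<close> of \<open>H \<times> 0 + N(M\<^sub>C)\<close>, and an operator
  whose range has finite codimension maps closed subspaces containing its kernel to closed
  subspaces, by the open mapping theorem.

  Conversely, let \<open>N(A\<^sup>p) = N(A\<^sup>p\<^sup>+\<^sup>1)\<close> and \<open>R(B\<^sup>q) = R(B\<^sup>q\<^sup>+\<^sup>1)\<close>. By the composition formulas the index equation
  says that \<open>L = R(B\<^sup>q) \<inter> N(B)\<close> and the orthogonal complement \<open>D\<close> of \<open>R(A) + N(A\<^sup>p)\<close> have the same
  dimension. Matching orthonormal bases yields an invertible \<open>C\<close> with \<open>C L = D\<close>. Then
  \<open>N(A\<^sup>p) \<times> 0 \<subseteq> H \<times> R(B\<^sup>q)\<close> is a flag of invariant subspaces for \<open>M\<^sub>C\<close>: on its ends \<open>M\<^sub>C\<close> is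
  nilpotent and finite-dimensional, and in the middle it is bijective, so \<open>M\<^sub>C\<close> is Browder.
\<close>

section \<open>Direct sums and dimensions\<close>

abbreviation csubspace :: "'a::complex_vector set \<Rightarrow> bool" where
  "csubspace \<equiv> complex_vector.subspace"

abbreviation cspan :: "'a::complex_vector set \<Rightarrow> 'a set" where
  "cspan \<equiv> complex_vector.span"

abbreviation cindependent :: "'a::complex_vector set \<Rightarrow> bool" where
  "cindependent \<equiv> complex_vector.independent"

abbreviation clinear :: "('a::complex_vector \<Rightarrow> 'b::complex_vector) \<Rightarrow> bool" where
  "clinear \<equiv> Vector_Spaces.linear scaleC scaleC"

interpretation clin: vector_space_pair
  "scaleC :: complex \<Rightarrow> 'a \<Rightarrow> 'a::complex_vector"
  "scaleC :: complex \<Rightarrow> 'b \<Rightarrow> 'b::complex_vector"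
  by unfold_locales

lemma clinear_iff:
  "clinear f \<longleftrightarrow> (\<forall>x y. f (x + y) = f x + f y) \<and> (\<forall>c x. f (c *\<^sub>C x) = c *\<^sub>C f x)"
  by (simp add: Vector_Spaces.linear_iff complex_vector.vector_space_axioms)

lemma csubspace_ker: "clinear f \<Longrightarrow> csubspace (ker f)"
  unfolding ker_def by (rule clin.linear_subspace_kernel)

lemma csubspace_range: "clinear f \<Longrightarrow> csubspace (range f)"
  by (rule clin.linear_subspace_image) simp_all

lemma clinear_funpow: "clinear f \<Longrightarrow> clinear (f ^^ n)" for f :: "'a::complex_vector \<Rightarrow> 'a"
  by (induction n) (auto simp: clinear_iff)

text \<open>A finite spanning set bounds the size of every independent set in its span, so an
  infinite \<open>B\<close> leaves no finite spanning set.\<close>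

lemma cdimension_span_independent:
  assumes "cindependent B"
  shows "cdimension (cspan B) = (if finite B then enat (card B) else \<infinity>)"
proof (cases "finite B")
  case True
  then show ?thesis
    using assms complex_vector.dim_eq_card_independent by (auto simp: cdimension_def)
next
  case False
  have "\<not> (finite B' \<and> cspan B' = cspan B)" for B' :: "'a set"
    using complex_vector.independent_span_bound[OF _ assms, of B'] False
      complex_vector.span_superset[of B] by auto
  then show ?thesis
    using False by (auto simp: cdimension_def)
qed

lemma csubspace_basis:
  assumes "csubspace V"
  obtains B where "cindependent B" "cspan B = V"
  using complex_vector.basis_exists[of V] assms
  by (metis complex_vector.span_subspace)

lemma cdimension_finiteD:
  assumes "cdimension V < \<infinity>" shows "\<exists>B. finite B \<and> cspan B = V"
  using assms by (auto simp: cdimension_def split: if_splits)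

lemma cdimension_finite_iff: "cdimension V < \<infinity> \<longleftrightarrow> (\<exists>B. finite B \<and> cspan B = V)"
  by (auto simp: cdimension_def)

text \<open>Purely algebraic, with no closedness of the summands, so that every subspace has a
  complement. Topological complements enter through \<open>orthocomplemented\<close>.\<close>

definition direct_sum :: "'a::complex_vector set \<Rightarrow> 'a set \<Rightarrow> 'a set \<Rightarrow> bool" where
  "direct_sum U W V \<longleftrightarrow>
    csubspace U \<and> csubspace W \<and> U \<inter> W = {0} \<and> V = {u + w |u w. u \<in> U \<and> w \<in> W}"

lemma direct_sumD:
  assumes "direct_sum U W V"
  shows "csubspace U" "csubspace W" "csubspace V" "U \<inter> W = {0}"
    "V = {u + w |u w. u \<in> U \<and> w \<in> W}" "U \<subseteq> V" "W \<subseteq> V"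
proof -
  show 1: "csubspace U" "csubspace W" "U \<inter> W = {0}" "V = {u + w |u w. u \<in> U \<and> w \<in> W}"
    using assms by (auto simp: direct_sum_def)
  show "csubspace V"
    using complex_vector.subspace_sums[OF 1(1,2)] 1(4) by simp
  show "U \<subseteq> V" "W \<subseteq> V"
    unfolding 1(4) using complex_vector.subspace_0[OF 1(1)] complex_vector.subspace_0[OF 1(2)]
    by force+
qed

lemma direct_sum_decompose:
  assumes "direct_sum U W V" "x \<in> V"
  obtains u w where "u \<in> U" "w \<in> W" "x = u + w"
  using assms unfolding direct_sum_def by auto

lemma direct_sum_unique:
  assumes "direct_sum U W V" "w \<in> W" "w' \<in> W" "x - w \<in> U" "x - w' \<in> U"
  shows "w = w'"
proof -
  have "w - w' \<in> W" "(x - w') - (x - w) \<in> U"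
    using assms(2-) complex_vector.subspace_diff direct_sumD(1,2)[OF assms(1)] by blast+
  then have "w - w' \<in> U \<inter> W" by simp
  then show ?thesis using direct_sumD[OF assms(1)] by simp
qed

text \<open>The union of bases of \<open>U\<close> and \<open>W\<close> is a basis of
  \<open>V\<close>: a vanishing combination splits into two parts that are negatives of each other,
  so both lie in \<open>U \<inter> W = {0}\<close>.\<close>

lemma cdimension_direct_sum:
  assumes "direct_sum U W V"
  shows "cdimension V = cdimension U + cdimension W"
proof -
  note D = direct_sumD[OF assms]
  obtain B where B: "cindependent B" "cspan B = U" using csubspace_basis D(1) by blast
  obtain C where C: "cindependent C" "cspan C = W" using csubspace_basis D(2) by blast
  have BC: "B \<inter> C = {}"
  proof -
    have "B \<inter> C \<subseteq> {0}"
      using B C D(4) complex_vector.span_superset[of B] complex_vector.span_superset[of C] by blast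
    moreover have "0 \<notin> B"
      using B(1) complex_vector.dependent_zero by blast
    ultimately show ?thesis by blast
  qed
  have "cindependent (B \<union> C)"
    unfolding complex_vector.independent_explicit_finite_subsets
  proof (intro allI impI ballI)
    fix F :: "'a set" and u v
    assume F: "F \<subseteq> B \<union> C" "finite F" "(\<Sum>v\<in>F. u v *\<^sub>C v) = 0" "v \<in> F"
    define b where "b = (\<Sum>v\<in>F \<inter> B. u v *\<^sub>C v)"
    define c where "c = (\<Sum>v\<in>F \<inter> C. u v *\<^sub>C v)"
    have FU: "F = (F \<inter> B) \<union> (F \<inter> C)" using F(1) by blast
    have "b + c = (\<Sum>v\<in>(F \<inter> B) \<union> (F \<inter> C). u v *\<^sub>C v)"
      unfolding b_def c_def using F(2) BC
      by (intro sum.union_disjoint[symmetric]) auto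
    then have bc: "b + c = 0" using F(3) FU by simp
    have "b \<in> U" "c \<in> W" unfolding b_def c_def B(2)[symmetric] C(2)[symmetric]
      by (intro complex_vector.span_sum complex_vector.span_scale complex_vector.span_base; simp)+
    moreover have "b = - c" using bc by (simp add: eq_neg_iff_add_eq_0)
    ultimately have "b \<in> U \<inter> W" using D(2) complex_vector.subspace_neg by blast
    then have "b = 0" "c = 0" using D(4) bc by auto
    then show "u v = 0"
      using complex_vector.independentD[OF B(1), of "F \<inter> B" u v]
        complex_vector.independentD[OF C(1), of "F \<inter> C" u v] F FU
      unfolding b_def c_def by (auto simp: F(2))
  qed
  moreover have "cspan (B \<union> C) = V"
    unfolding complex_vector.span_Un B C D(5) by simp
  ultimately show ?thesis
    using cdimension_span_independent[of "B \<union> C"] cdimension_span_independent[OF B(1)]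
      cdimension_span_independent[OF C(1)] B C BC
    by (auto simp: card_Un_disjoint)
qed

text \<open>A basis \<open>B\<close> of \<open>U\<close> extends to a basis \<open>C\<close> of
  \<open>V\<close>, and the span of \<open>C - B\<close> is a complement.\<close>

lemma direct_sum_exists:
  assumes "csubspace U" "csubspace V" "U \<subseteq> V"
  shows "\<exists>W. direct_sum U W V"
proof -
  obtain B where B: "B \<subseteq> U" "cindependent B" "cspan B = U"
    using complex_vector.basis_exists[of U] assms(1) complex_vector.span_subspace by metis
  obtain C where C: "B \<subseteq> C" "C \<subseteq> V" "cindependent C" "V \<subseteq> cspan C"
    using complex_vector.maximal_independent_subset_extend[of B V] B assms by blast
  have CV: "cspan C = V"
    using C assms(2) complex_vector.span_subspace by blast
  \<comment> \<open>The coordinates of \<open>x\<close> in the basis \<open>C\<close> are supported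
    both in \<open>B\<close> and in \<open>C - B\<close>, hence all vanish.\<close>
  have "x = 0" if x: "x \<in> cspan B" "x \<in> cspan (C - B)" for x
  proof -
    have "complex_vector.representation C x v = 0" for v
    proof (cases "v \<in> B")
      case True
      have "complex_vector.representation C x = complex_vector.representation (C - B) x"
        using complex_vector.representation_extend[OF C(3) x(2)] by blast
      then show ?thesis
        using True complex_vector.representation_ne_zero[of "C - B" x v] by auto
    next
      case False
      have "complex_vector.representation C x = complex_vector.representation B x"
        using complex_vector.representation_extend[OF C(3) x(1)] C by blast
      then show ?thesis
        using False complex_vector.representation_ne_zero[of B x v] by auto
    qed
    then show ?thesis
      using complex_vector.sum_nonzero_representation_eq[OF C(3), of x] x C
        complex_vector.span_mono[of B C] by auto
  qed
  then have "cspan B \<inter> cspan (C - B) = {0}"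
    using complex_vector.span_zero by blast
  moreover have "V = {u + w |u w. u \<in> cspan B \<and> w \<in> cspan (C - B)}"
    using complex_vector.span_Un[of B "C - B"] C(1) CV by (simp add: Un_absorb1)
  ultimately have "direct_sum U (cspan (C - B)) V"
    unfolding direct_sum_def B(3)[symmetric] by simp
  then show ?thesis ..
qed

lemma direct_sum_complement: "csubspace U \<Longrightarrow> \<exists>W. direct_sum U W UNIV"
  by (rule direct_sum_exists) simp_all

text \<open>Along a chain of subspaces \<open>U\<close>, \<open>V\<close>, \<open>Z\<close>, the two
  relative complements combine to a complement of \<open>U\<close> in \<open>Z\<close>. This is how
  the defects in a composition are split.\<close>

lemma direct_sum_assoc:
  assumes UWV: "direct_sum U W V" and VOZ: "direct_sum V X Z"
  obtains Q where "direct_sum W X Q" "direct_sum U Q Z"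
proof -
  note D = direct_sumD[OF UWV] and E = direct_sumD[OF VOZ]
  define Q where "Q = {w + x |w x. w \<in> W \<and> x \<in> X}"
  have "W \<inter> X = {0}"
    using D(7) E(4) complex_vector.subspace_0[OF D(2)] complex_vector.subspace_0[OF E(2)] by blast
  then have Q: "direct_sum W X Q"
    unfolding direct_sum_def Q_def using D(2) E(2) by simp
  have "U \<inter> Q \<subseteq> {0}"
  proof
    fix u assume "u \<in> U \<inter> Q"
    then obtain w x where wx: "w \<in> W" "x \<in> X" "u = w + x" "u \<in> U" by (auto simp: Q_def)
    have "u - w \<in> V" using wx D(6,7) by (intro complex_vector.subspace_diff[OF D(3)]) auto
    then have "x \<in> V \<inter> X" using wx by simp
    then have "x = 0" using E by simp
    then have "u \<in> U \<inter> W" using wx by simp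
    then show "u \<in> {0}" using D by simp
  qed
  then have "U \<inter> Q = {0}"
    using complex_vector.subspace_0[OF D(1)]
      complex_vector.subspace_0[OF direct_sumD(3)[OF Q]] by blast
  moreover have "Z = {u + q |u q. u \<in> U \<and> q \<in> Q}"
  proof (intro equalityI subsetI)
    fix z assume "z \<in> Z"
    then obtain v x where z: "z = v + x" "v \<in> V" "x \<in> X" using E(5) by blast
    then obtain u w where v: "v = u + w" "u \<in> U" "w \<in> W" using D(5) by blast
    have "w + x \<in> Q" unfolding Q_def using v z by blast
    moreover have "z = u + (w + x)" using v z by (simp add: add.assoc)
    ultimately show "z \<in> {u + q |u q. u \<in> U \<and> q \<in> Q}" using v by blast
  next
    fix z assume "z \<in> {u + q |u q. u \<in> U \<and> q \<in> Q}"
    then obtain u w x where z: "z = u + (w + x)" "u \<in> U" "w \<in> W" "x \<in> X"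
      unfolding Q_def by blast
    then have "z = (u + w) + x" "u + w \<in> V" using D(5) by (auto simp: add.assoc)
    then show "z \<in> Z" using z E(5) by blast
  qed
  ultimately have "direct_sum U Q Z"
    unfolding direct_sum_def using D(1) direct_sumD(3)[OF Q] by simp
  then show thesis using Q that by blast
qed

text \<open>A form of the second isomorphism theorem: what \<open>N\<close> adds to \<open>R\<close>
  is a complement of \<open>R \<inter> N\<close> in \<open>N\<close>.\<close>

lemma direct_sum_of_inter:
  assumes R: "csubspace R" and N: "direct_sum (R \<inter> N) Q N"
  shows "direct_sum R Q {r + n |r n. r \<in> R \<and> n \<in> N}"
proof -
  note D = direct_sumD[OF N]
  have "R \<inter> Q = {0}"
    using D(4,7) complex_vector.subspace_0[OF R] complex_vector.subspace_0[OF D(2)] by blast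
  moreover have "{r + n |r n. r \<in> R \<and> n \<in> N} = {r + q |r q. r \<in> R \<and> q \<in> Q}"
  proof (intro equalityI subsetI)
    fix z assume "z \<in> {r + n |r n. r \<in> R \<and> n \<in> N}"
    then obtain r n where z: "z = r + n" "r \<in> R" "n \<in> N" by blast
    obtain p q where n: "n = p + q" "p \<in> R" "q \<in> Q" using D(5) z(3) by blast
    show "z \<in> {r + q |r q. r \<in> R \<and> q \<in> Q}"
      using z n complex_vector.subspace_add[OF R, of r p] by (auto simp: add.assoc[symmetric])
  qed (use D(7) in blast)
  ultimately show ?thesis
    by (simp only: direct_sum_def R D(2) simp_thms)
qed

lemma cdimension_inj_image:
  assumes f: "clinear f" and V: "csubspace V" and inj: "ker f \<inter> V = {0}"
  shows "cdimension (f ` V) = cdimension V"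
proof -
  obtain B where B: "cindependent B" "cspan B = V" using csubspace_basis V by blast
  have "inj_on f V"
  proof (rule inj_onI)
    fix x y assume xy: "x \<in> V" "y \<in> V" "f x = f y"
    have "x - y \<in> ker f \<inter> V"
      using xy V complex_vector.subspace_diff clin.linear_diff[OF f] by (auto simp: ker_def)
    then show "x = y" using inj by simp
  qed
  then have "cindependent (f ` B)" "inj_on f B"
    using clin.linear_independent_injective_image[OF f B(1)] B(2)
      inj_on_subset[OF _ complex_vector.span_superset[of B]] by simp_all
  then have "cdimension (cspan (f ` B)) = cdimension (cspan B)"
    using B(1) by (simp add: cdimension_span_independent card_image finite_image_iff)
  then show ?thesis unfolding clin.linear_span_image[OF f, of B] B(2) .
qed

text \<open>A complement of \<open>ker f \<inter> V\<close> in \<open>V\<close> is mapped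
  injectively onto the image of \<open>V\<close>. Infinite dimensions are covered, since additivity
  over direct sums holds in \<open>enat\<close>.\<close>

lemma rank_nullity:
  assumes f: "clinear f" and V: "csubspace V"
  shows "cdimension V = cdimension (ker f \<inter> V) + cdimension (f ` V)"
proof -
  obtain W where W: "direct_sum (ker f \<inter> V) W V"
    using direct_sum_exists[OF complex_vector.subspace_inter[OF csubspace_ker[OF f] V] V]
    by blast
  note D = direct_sumD[OF W]
  have "ker f \<inter> W = {0}" using D by blast
  moreover have "f ` V = f ` W"
  proof
    show "f ` V \<subseteq> f ` W"
    proof
      fix y assume "y \<in> f ` V"
      then obtain x where x: "x \<in> V" "y = f x" by blast
      obtain u w where "u \<in> ker f \<inter> V" "w \<in> W" "x = u + w"
        using direct_sum_decompose[OF W x(1)] .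
      then show "y \<in> f ` W" using x(2) clin.linear_add[OF f] by (simp add: ker_def)
    qed
    show "f ` W \<subseteq> f ` V" using D(7) by (rule image_mono)
  qed
  ultimately show ?thesis
    using cdimension_direct_sum[OF W] cdimension_inj_image[OF f D(2)] by simp
qed

lemma cdimension_mono:
  assumes "csubspace U" "csubspace V" "U \<subseteq> V"
  shows "cdimension U \<le> cdimension V"
proof -
  obtain W where "direct_sum U W V" using direct_sum_exists[OF assms] ..
  then show ?thesis by (simp add: cdimension_direct_sum)
qed

section \<open>Projections and codimension\<close>

lemma direct_sum_projection:
  assumes "direct_sum V W UNIV"
  obtains P where "clinear P" "ker P = V" "range P = W"
proof -
  note D = direct_sumD[OF assms]
  have "\<exists>w. w \<in> W \<and> x - w \<in> V" for x
  proof -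
    obtain v w where "v \<in> V" "w \<in> W" "x = v + w"
      using direct_sum_decompose[OF assms UNIV_I] .
    then show ?thesis by (intro exI[of _ w]) simp
  qed
  then obtain P where P: "\<And>x. P x \<in> W" "\<And>x. x - P x \<in> V" by metis
  have eq: "P x = w" if "w \<in> W" "x - w \<in> V" for x w
    using direct_sum_unique[OF assms] P that by blast
  have "clinear P"
    unfolding clinear_iff
  proof (intro conjI allI)
    fix x y c
    have "(x - P x) + (y - P y) \<in> V" "c *\<^sub>C (x - P x) \<in> V"
      using P D(1) complex_vector.subspace_add complex_vector.subspace_scale by blast+
    then show "P (x + y) = P x + P y" "P (c *\<^sub>C x) = c *\<^sub>C P x"
      using P D(2) by (auto intro!: eq complex_vector.subspace_add complex_vector.subspace_scale
          simp: algebra_simps complex_vector.scale_right_diff_distrib)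
  qed
  moreover have "ker P = V"
  proof (intro equalityI subsetI)
    fix x assume "x \<in> ker P"
    then show "x \<in> V" using P(2)[of x] by (simp add: ker_def)
  next
    fix x assume "x \<in> V"
    then show "x \<in> ker P"
      using eq[OF complex_vector.subspace_0[OF D(2)], of x] by (simp add: ker_def)
  qed
  moreover have "range P = W"
  proof (intro equalityI subsetI)
    fix w assume "w \<in> W"
    then have "P w = w" using eq[of w w] complex_vector.subspace_0[OF D(1)] by simp
    then show "w \<in> range P" by (metis rangeI)
  qed (use P(1) in blast)
  ultimately show thesis by (rule that)
qed

text \<open>The projection onto \<open>W\<close> along \<open>V\<close> is a model of the quotient
  map. It carries the span of a finite quotient basis isomorphically onto \<open>W\<close>. If there
  is no finite quotient basis, then a basis of \<open>W\<close>, being a quotient basis, is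
  infinite.\<close>

lemma codimension_eq_cdimension:
  assumes VW: "direct_sum V W UNIV"
  shows "codimension V = cdimension W"
proof (cases "\<exists>C. finite C \<and> quotient_basis V C")
  case True
  then obtain C where C: "finite C" "quotient_basis V C" by blast
  have zero: "\<forall>b\<in>F. u b = 0" if "finite F" "F \<subseteq> C" "(\<Sum>b\<in>F. u b *\<^sub>C b) \<in> V" for F u
    using C(2) that unfolding quotient_basis_def by blast
  have V: "csubspace V" using direct_sumD[OF VW] by blast
  obtain P where P: "clinear P" "ker P = V" "range P = W" using direct_sum_projection[OF VW] .
  have indep: "cindependent C"
    unfolding complex_vector.independent_explicit_finite_subsets
    using zero complex_vector.subspace_0[OF V] by metis
  have "x = 0" if x: "x \<in> ker P \<inter> cspan C" for x
  proof -
    obtain u where u: "x = (\<Sum>b\<in>C. u b *\<^sub>C b)"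
      using x unfolding complex_vector.span_finite[OF C(1)] by blast
    then show ?thesis using zero[of C u] x C(1) P(2) by simp
  qed
  then have "ker P \<inter> cspan C = {0}"
    using complex_vector.span_zero csubspace_ker[OF P(1)] complex_vector.subspace_0 by blast
  then have "cdimension (P ` cspan C) = cdimension (cspan C)"
    using cdimension_inj_image P(1) by blast
  moreover have "P ` cspan C = W"
  proof -
    have "P x \<in> P ` cspan C" for x
    proof -
      obtain y where y: "y \<in> cspan C" "x - y \<in> ker P"
        using C(2) P(2) unfolding quotient_basis_def by blast
      then have "P x = P y" using clin.linear_diff[OF P(1)] by (simp add: ker_def)
      then show ?thesis using y by blast
    qed
    then show ?thesis using P(3) by blast
  qed
  ultimately show ?thesis
    using codimension_eq[OF V C] cdimension_span_independent[OF indep] C(1) by simp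
next
  case False
  obtain B where B: "cindependent B" "cspan B = W"
    using csubspace_basis direct_sumD(2)[OF VW] by blast
  have "quotient_basis V B"
    unfolding quotient_basis_def
  proof (intro conjI allI impI)
    fix F u assume F: "finite F \<and> F \<subseteq> B \<and> (\<Sum>b\<in>F. u b *\<^sub>C b) \<in> V"
    have "(\<Sum>b\<in>F. u b *\<^sub>C b) \<in> W"
      unfolding B(2)[symmetric] using F
      by (intro complex_vector.span_sum complex_vector.span_scale complex_vector.span_base) blast
    then have "(\<Sum>b\<in>F. u b *\<^sub>C b) = 0" using F direct_sumD(4)[OF VW] by blast
    then show "\<forall>b\<in>F. u b = 0"
      using complex_vector.independentD[OF B(1)] F by blast
  next
    fix x
    obtain v w where "v \<in> V" "w \<in> W" "x = v + w"
      using direct_sum_decompose[OF VW UNIV_I] .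
    then show "\<exists>y\<in>cspan B. x - y \<in> V" using B(2) by (intro bexI[of _ w]) auto
  qed
  then have "infinite B" using False by blast
  then show ?thesis
    using False cdimension_span_independent[OF B(1)] B(2) by (simp add: codimension_def)
qed

text \<open>A criterion that asks only for a finite set spanning modulo \<open>V\<close>: its image
  under the projection along \<open>V\<close> spans a complement.\<close>

lemma codimension_finite_iff:
  assumes V: "csubspace V"
  shows "codimension V < \<infinity> \<longleftrightarrow> (\<exists>F. finite F \<and> (\<forall>x. \<exists>y\<in>cspan F. x - y \<in> V))"
proof
  assume "codimension V < \<infinity>"
  then show "\<exists>F. finite F \<and> (\<forall>x. \<exists>y\<in>cspan F. x - y \<in> V)"
    by (auto simp: codimension_def quotient_basis_def split: if_splits)
next
  assume "\<exists>F. finite F \<and> (\<forall>x. \<exists>y\<in>cspan F. x - y \<in> V)"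
  then obtain F where F: "finite F" "\<And>x. \<exists>y\<in>cspan F. x - y \<in> V" by blast
  obtain W where W: "direct_sum V W UNIV" using direct_sum_complement[OF V] ..
  obtain P where P: "clinear P" "ker P = V" "range P = W" using direct_sum_projection[OF W] .
  have "W = P ` cspan F"
  proof -
    have "P x \<in> P ` cspan F" for x
    proof -
      obtain y where y: "y \<in> cspan F" "x - y \<in> ker P" using F(2) P(2) by blast
      then have "P x = P y" using clin.linear_diff[OF P(1)] by (simp add: ker_def)
      then show ?thesis using y by blast
    qed
    then show ?thesis using P(3) by blast
  qed
  then have "cspan (P ` F) = W" using clin.linear_span_image[OF P(1)] by metis
  then show "codimension V < \<infinity>"
    using codimension_eq_cdimension[OF W] F(1) cdimension_finite_iff by (metis finite_imageI)
qed

text \<open>The projection along \<open>V\<close> has kernel \<open>U \<inter> V\<close> on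
  \<open>U\<close> and maps \<open>U\<close> into a finite-dimensional complement of
  \<open>V\<close>, so rank-nullity applies.\<close>

lemma cdimension_finite_of_codimension:
  assumes U: "csubspace U" and V: "csubspace V" "codimension V < \<infinity>"
    and UV: "cdimension (U \<inter> V) < \<infinity>"
  shows "cdimension U < \<infinity>"
proof -
  obtain W where W: "direct_sum V W UNIV" using direct_sum_complement[OF V(1)] ..
  obtain P where P: "clinear P" "ker P = V" "range P = W" using direct_sum_projection[OF W] .
  have "cdimension (P ` U) \<le> cdimension W"
    using P direct_sumD(2)[OF W] clin.linear_subspace_image[OF P(1) U]
    by (intro cdimension_mono) auto
  then have "cdimension (P ` U) < \<infinity>"
    using codimension_eq_cdimension[OF W] V(2) by (metis order_le_less_trans)
  then show ?thesis
    using rank_nullity[OF P(1) U] UV P(2) by (auto simp: Int_commute)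
qed

text \<open>Let \<open>Q\<close> complement \<open>range T \<inter> ker S\<close> in
  \<open>ker S\<close>, and let \<open>X\<close> complement \<open>RN\<close>, the sum of
  \<open>range T\<close> and \<open>ker S\<close>. Then \<open>b\<close> is the dimension of
  \<open>Q\<close>, the defect of \<open>T\<close> is counted by \<open>Q\<close> and
  \<open>X\<close> together, and the image of \<open>X\<close> under \<open>S\<close> complements
  \<open>range (S \<circ> T)\<close> in \<open>range S\<close>.\<close>

lemma composition_dimensions:
  fixes T :: "'a::complex_vector \<Rightarrow> 'b::complex_vector" and S :: "'b \<Rightarrow> 'c::complex_vector"
  assumes T: "clinear T" and S: "clinear S"
  defines "a \<equiv> cdimension (range T \<inter> ker S)"
    and "c \<equiv> codimension {r + n |r n. r \<in> range T \<and> n \<in> ker S}"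
  shows "nullity (S \<circ> T) = nullity T + a"
    and "defect (S \<circ> T) = defect S + c"
    and "\<exists>b. nullity S = a + b \<and> defect T = b + c"
proof -
  have ST: "clinear (S \<circ> T)" using S T by (simp add: clinear_iff)
  have "ker T \<inter> ker (S \<circ> T) = ker T" "T ` ker (S \<circ> T) = range T \<inter> ker S"
    using clin.linear_0[OF S] by (auto simp: ker_def)
  then show "nullity (S \<circ> T) = nullity T + a"
    using rank_nullity[OF T csubspace_ker[OF ST]] by (simp add: nullity_def a_def)
  define RN where "RN = {r + n |r n. r \<in> range T \<and> n \<in> ker S}"
  obtain Q where Q: "direct_sum (range T \<inter> ker S) Q (ker S)"
    using direct_sum_exists[OF complex_vector.subspace_inter[OF csubspace_range[OF T]
        csubspace_ker[OF S]] csubspace_ker[OF S]] by blast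
  have RQ: "direct_sum (range T) Q RN"
    unfolding RN_def using direct_sum_of_inter[OF csubspace_range[OF T] Q] .
  obtain X where X: "direct_sum RN X UNIV"
    using direct_sum_complement[OF direct_sumD(3)[OF RQ]] ..
  note DX = direct_sumD[OF X]
  have c: "c = cdimension X" using codimension_eq_cdimension[OF X] by (simp add: c_def RN_def)
  obtain QX where QX: "direct_sum Q X QX" "direct_sum (range T) QX UNIV"
    using direct_sum_assoc[OF RQ X] .
  have "nullity S = a + cdimension Q"
    using cdimension_direct_sum[OF Q] by (simp add: nullity_def a_def)
  moreover have "defect T = cdimension Q + c"
    using codimension_eq_cdimension[OF QX(2)] cdimension_direct_sum[OF QX(1)] c
    by (simp add: defect_def)
  ultimately show "\<exists>b. nullity S = a + b \<and> defect T = b + c" by blast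
  \<comment> \<open>Injectivity of \<open>S\<close> on \<open>X\<close>, so that the image of
    \<open>X\<close> still has dimension \<open>c\<close>.\<close>
  have kerX: "ker S \<inter> X = {0}"
  proof -
    have "ker S \<subseteq> RN"
      unfolding RN_def using complex_vector.subspace_0[OF csubspace_range[OF T]] by force
    then show ?thesis using DX(4) complex_vector.subspace_0[OF DX(2)] 
        complex_vector.subspace_0[OF csubspace_ker[OF S]] by blast
  qed
  have SRN: "S ` RN = range (S \<circ> T)"
  proof
    show "S ` RN \<subseteq> range (S \<circ> T)"
      unfolding RN_def using clin.linear_add[OF S] by (auto simp: ker_def)
    have "range T \<subseteq> RN" using direct_sumD(6)[OF RQ] .
    then show "range (S \<circ> T) \<subseteq> S ` RN" by auto
  qed
  have "direct_sum (range (S \<circ> T)) (S ` X) (range S)"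
    unfolding direct_sum_def
  proof (intro conjI)
    show "csubspace (range (S \<circ> T))" using csubspace_range[OF ST] .
    show "csubspace (S ` X)" using clin.linear_subspace_image[OF S DX(2)] .
    have "z = 0" if z: "z \<in> range (S \<circ> T)" "z \<in> S ` X" for z
    proof -
      obtain t where t: "z = S (T t)" using z(1) by auto
      obtain x where "z = S x" "x \<in> X" using z(2) by blast
      note tx = t this
      have "x - T t \<in> ker S" using clin.linear_diff[OF S] tx by (simp add: ker_def)
      then have "T t + (x - T t) \<in> RN" unfolding RN_def by blast
      then have "x \<in> RN \<inter> X" using tx by simp
      then show ?thesis using DX(4) tx clin.linear_0[OF S] by simp
    qed
    then show "range (S \<circ> T) \<inter> S ` X = {0}"
      using complex_vector.subspace_0[OF csubspace_range[OF ST]]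
        complex_vector.subspace_0[OF clin.linear_subspace_image[OF S DX(2)]] by blast
    show "range S = {u + w |u w. u \<in> range (S \<circ> T) \<and> w \<in> S ` X}"
    proof (intro equalityI subsetI)
      fix z assume "z \<in> range S"
      then obtain y where y: "z = S y" by blast
      obtain u x where "u \<in> RN" "x \<in> X" "y = u + x"
        using direct_sum_decompose[OF X UNIV_I] .
      then show "z \<in> {u + w |u w. u \<in> range (S \<circ> T) \<and> w \<in> S ` X}"
        using y clin.linear_add[OF S] SRN by blast
    qed (auto simp: clin.linear_add[OF S, symmetric])
  qed
  moreover obtain Z where Z: "direct_sum (range S) Z UNIV"
    using direct_sum_complement[OF csubspace_range[OF S]] ..
  ultimately obtain Y where "direct_sum (S ` X) Z Y" "direct_sum (range (S \<circ> T)) Y UNIV"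
    using direct_sum_assoc[of _ _ "range S" Z UNIV] by metis
  then show "defect (S \<circ> T) = defect S + c"
    using codimension_eq_cdimension cdimension_direct_sum Z c
      cdimension_inj_image[OF S DX(2) kerX] by (metis defect_def add.commute)
qed

text \<open>Additivity of the index, written with sums only, so that it remains meaningful when some
  of the values are infinite.\<close>

lemma index_composition:
  assumes "clinear T" "clinear S"
  shows "nullity T + nullity S + defect (S \<circ> T) = nullity (S \<circ> T) + defect T + defect S"
  using composition_dimensions[OF assms] by (auto simp: ac_simps)

section \<open>The complex inner product\<close>

instance chilbert_space \<subseteq> banach ..

lemma cinner_add_right: "cinner x (y + z) = cinner x y + cinner x z" for x :: "'a::complex_inner"
  by (metis cinner_add_left cinner_commute complex_cnj_add)

lemma cinner_scaleC_right: "cinner x (a *\<^sub>C y) = cnj a * cinner x y" for x :: "'a::complex_inner"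
  by (metis cinner_commute cinner_scaleC_left complex_cnj_mult)

lemma cinner_eq_norm: "cinner x x = complex_of_real ((norm x)\<^sup>2)" for x :: "'a::complex_inner"
proof (rule complex_eqI)
  show "Re (cinner x x) = Re (complex_of_real ((norm x)\<^sup>2))"
    using inner_eq_Re_cinner[of x x] by (simp add: power2_norm_eq_inner)
  show "Im (cinner x x) = Im (complex_of_real ((norm x)\<^sup>2))"
    using cinner_commute[of x x] by (simp add: complex_eq_iff)
qed

lemma cinner_self_eq_0: "cinner x x = 0 \<longleftrightarrow> x = 0" for x :: "'a::complex_inner"
  by (simp add: cinner_eq_norm)

text \<open>The class axioms tie the norm to the real inner product, so homogeneity for complex
  scalars has to be read off \<open>cinner x x\<close>.\<close>

lemma norm_scaleC: "norm (a *\<^sub>C x) = cmod a * norm x" for x :: "'a::complex_inner"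
proof -
  have "complex_of_real ((norm (a *\<^sub>C x))\<^sup>2) = a * cnj a * cinner x x"
    unfolding cinner_eq_norm[symmetric] by (simp add: cinner_scaleC_left cinner_scaleC_right)
  also have "\<dots> = complex_of_real ((cmod a * norm x)\<^sup>2)"
    unfolding cinner_eq_norm complex_norm_square[symmetric] by (simp add: power_mult_distrib)
  finally have "(norm (a *\<^sub>C x))\<^sup>2 = (cmod a * norm x)\<^sup>2"
    using of_real_eq_iff by blast
  then show ?thesis by (simp add: power2_eq_iff_nonneg)
qed

lemma cmod_cinner_le: "cmod (cinner x y) \<le> norm x * norm y" for x :: "'a::complex_inner"
proof (cases "cinner x y = 0")
  case False
  define c where "c = cinner x y"
  \<comment> \<open>A unimodular scalar that rotates \<open>c\<close> to its modulus; the real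
    Cauchy-Schwarz inequality then applies to \<open>a *\<^sub>C x\<close> and
    \<open>y\<close>.\<close>
  define a where "a = cnj c / complex_of_real (cmod c)"
  have c: "cmod c \<noteq> 0" using False by (simp add: c_def)
  have "cnj c * c = complex_of_real ((cmod c)\<^sup>2)"
    by (metis complex_norm_square mult.commute of_real_power)
  then have "a * c = complex_of_real (cmod c)"
    using c by (simp add: a_def power2_eq_square)
  then have "cmod c = inner (a *\<^sub>C x) y"
    by (simp add: inner_eq_Re_cinner cinner_scaleC_left c_def)
  also have "\<dots> \<le> norm (a *\<^sub>C x) * norm y" by (rule norm_cauchy_schwarz)
  also have "norm (a *\<^sub>C x) = norm x"
    using c by (simp add: norm_scaleC a_def norm_divide)
  finally show ?thesis by (simp add: c_def)
qed simp

lemma bounded_linear_cinner_left: "bounded_linear (\<lambda>x. cinner x y)" for y :: "'a::complex_inner"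
  using cmod_cinner_le
  by (intro bounded_linear_intro[of _ "norm y"])
    (simp_all add: cinner_add_left scaleR_scaleC cinner_scaleC_left scaleR_conv_of_real)

lemma bounded_linear_scaleC: "bounded_linear (\<lambda>x::'a::complex_inner. a *\<^sub>C x)"
  by (intro bounded_linear_intro[of _ "cmod a"])
    (simp_all add: scaleC_add_right norm_scaleC scaleR_scaleC scaleC_scaleC mult.commute)

lemma cinner_0_left: "cinner 0 y = 0" for y :: "'a::complex_inner"
  using linear_0[OF bounded_linear.linear[OF bounded_linear_cinner_left]] .

lemma cinner_0_right: "cinner x 0 = 0" for x :: "'a::complex_inner"
  by (metis cinner_0_left cinner_commute complex_cnj_zero)

lemma cinner_diff_left: "cinner (x - y) z = cinner x z - cinner y z" for x :: "'a::complex_inner"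
  using linear_diff[OF bounded_linear.linear[OF bounded_linear_cinner_left]] .

lemma cinner_sum_left: "cinner (sum f F) y = (\<Sum>i\<in>F. cinner (f i) y)"
  for y :: "'a::complex_inner"
  using linear_sum[OF bounded_linear.linear[OF bounded_linear_cinner_left]] .

lemma cinner_sum_right: "cinner y (sum f F) = (\<Sum>i\<in>F. cinner y (f i))"
  for y :: "'a::complex_inner"
  by (simp add: cinner_commute[of y] cinner_sum_left)

lemma cinner_eq_0_commute: "cinner x y = 0 \<longleftrightarrow> cinner y x = 0" for x :: "'a::complex_inner"
  by (metis cinner_commute complex_cnj_zero)

section \<open>Orthonormal families\<close>

text \<open>An indexed family rather than a set, so that a basis \<open>E\<close> and its image
  under a map \<open>\<phi>\<close> can share the index set \<open>E\<close>.\<close>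

definition orthonormal_on :: "'i set \<Rightarrow> ('i \<Rightarrow> 'a::complex_inner) \<Rightarrow> bool" where
  "orthonormal_on I \<phi> \<longleftrightarrow> (\<forall>i\<in>I. \<forall>j\<in>I. cinner (\<phi> i) (\<phi> j) = (if i = j then 1 else 0))"

lemma cinner_orthonormal_sum:
  assumes "orthonormal_on I \<phi>" "finite F" "F \<subseteq> I" "j \<in> I"
  shows "cinner (\<Sum>i\<in>F. c i *\<^sub>C \<phi> i) (\<phi> j) = (if j \<in> F then c j else 0)"
proof -
  have "cinner (\<Sum>i\<in>F. c i *\<^sub>C \<phi> i) (\<phi> j) = (\<Sum>i\<in>F. if i = j then c i else 0)"
    unfolding cinner_sum_left using assms
    by (intro sum.cong) (auto simp: cinner_scaleC_left orthonormal_on_def subset_iff)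
  then show ?thesis using assms(2) by simp
qed

lemma norm_orthonormal_sum:
  assumes "orthonormal_on I \<phi>" "finite F" "F \<subseteq> I"
  shows "(norm (\<Sum>i\<in>F. c i *\<^sub>C \<phi> i))\<^sup>2 = (\<Sum>i\<in>F. (cmod (c i))\<^sup>2)"
proof -
  have "complex_of_real ((norm (\<Sum>i\<in>F. c i *\<^sub>C \<phi> i))\<^sup>2)
      = (\<Sum>j\<in>F. cnj (c j) * cinner (\<Sum>i\<in>F. c i *\<^sub>C \<phi> i) (\<phi> j))"
    unfolding cinner_eq_norm[symmetric] by (simp add: cinner_sum_right cinner_scaleC_right)
  also have "\<dots> = (\<Sum>j\<in>F. complex_of_real ((cmod (c j))\<^sup>2))"
    using assms by (intro sum.cong refl)
      (auto simp: cinner_orthonormal_sum subset_iff complex_norm_square simp del: of_real_power)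
  finally show ?thesis
    unfolding of_real_sum[symmetric] using of_real_eq_iff by blast
qed

text \<open>With \<open>s\<close> the partial expansion of \<open>x\<close>,
  \<open>inner x s\<close> equals the squared norm of \<open>s\<close>, and the bound follows from
  \<open>inner (x - s) (x - s)\<close> being nonnegative.\<close>

lemma bessel_inequality:
  assumes "orthonormal_on I \<phi>" "finite F" "F \<subseteq> I"
  shows "(\<Sum>i\<in>F. (cmod (cinner x (\<phi> i)))\<^sup>2) \<le> (norm x)\<^sup>2"
proof -
  define s where "s = (\<Sum>i\<in>F. cinner x (\<phi> i) *\<^sub>C \<phi> i)"
  have s: "(norm s)\<^sup>2 = (\<Sum>i\<in>F. (cmod (cinner x (\<phi> i)))\<^sup>2)"
    unfolding s_def by (rule norm_orthonormal_sum[OF assms])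
  have "cinner x s = (\<Sum>i\<in>F. complex_of_real ((cmod (cinner x (\<phi> i)))\<^sup>2))"
    unfolding s_def cinner_sum_right
    by (intro sum.cong refl)
      (simp add: cinner_scaleC_right complex_norm_square mult.commute del: of_real_power)
  then have "inner x s = (norm s)\<^sup>2"
    unfolding s inner_eq_Re_cinner by simp
  moreover have "0 \<le> inner (x - s) (x - s)" by simp
  ultimately show ?thesis
    unfolding s[symmetric]
    by (simp add: inner_diff_left inner_diff_right inner_commute[of s x] power2_norm_eq_inner)
qed

lemma square_summable_coefficients:
  assumes "orthonormal_on I \<phi>"
  shows "(\<lambda>i. (cmod (cinner x (\<phi> i)))\<^sup>2) summable_on I"
proof (rule nonneg_bdd_above_summable_on)
  show "bdd_above (sum (\<lambda>i. (cmod (cinner x (\<phi> i)))\<^sup>2) ` {F. F \<subseteq> I \<and> finite F})"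
    using bessel_inequality[OF assms] by (intro bdd_aboveI[of _ "(norm x)\<^sup>2"]) auto
qed simp

text \<open>By the Pythagorean identity, squared distances between nested finite partial sums are
  partial sums of the coefficient series. The net of finite partial sums is therefore Cauchy, and
  completeness gives its limit.\<close>

lemma riesz_fischer:
  fixes \<phi> :: "'i \<Rightarrow> 'a::chilbert_space"
  assumes on: "orthonormal_on I \<phi>" and c: "(\<lambda>i. (cmod (c i))\<^sup>2) summable_on I"
  shows "(\<lambda>i. c i *\<^sub>C \<phi> i) summable_on I"
proof -
  define X where "X = sum (\<lambda>i. c i *\<^sub>C \<phi> i)"
  define q where "q = (\<lambda>i. (cmod (c i))\<^sup>2)"
  have "\<exists>P. eventually P (finite_subsets_at_top I) \<and> (\<forall>F G. P F \<and> P G \<longrightarrow> dist (X F) (X G) < e)"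
    if e: "e > 0" for e :: real
  proof -
    have "(sum q \<longlongrightarrow> infsum q I) (finite_subsets_at_top I)"
      using c infsum_tendsto unfolding q_def by blast
    then have "\<forall>\<^sub>F F in finite_subsets_at_top I. dist (sum q F) (infsum q I) < (e/2)\<^sup>2"
      using e by (intro tendstoD) simp_all
    then obtain F0 where F0: "finite F0" "F0 \<subseteq> I" "dist (sum q F0) (infsum q I) < (e/2)\<^sup>2"
      by (auto simp: eventually_finite_subsets_at_top)
    have near: "dist (X F) (X F0) < e/2" if F: "finite F" "F0 \<subseteq> F" "F \<subseteq> I" for F
    proof -
      have "X F - X F0 = X (F - F0)" unfolding X_def using F by (simp add: sum_diff)
      moreover have "(norm (X (F - F0)))\<^sup>2 = sum q (F - F0)"
        unfolding X_def q_def by (rule norm_orthonormal_sum[OF on]) (use F in auto)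
      moreover have "sum q (F - F0) = sum q F - sum q F0" using F by (simp add: sum_diff)
      moreover have "sum q F \<le> infsum q I"
        using c F by (intro finite_sum_le_infsum) (auto simp: q_def)
      ultimately have "(dist (X F) (X F0))\<^sup>2 < (e/2)\<^sup>2"
        using F0(3) by (simp add: dist_norm abs_less_iff)
      then show ?thesis using e by (intro power_less_imp_less_base[of _ 2 "e/2"]) simp_all
    qed
    show ?thesis
    proof (intro exI conjI allI impI)
      show "\<forall>\<^sub>F F in finite_subsets_at_top I. finite F \<and> F0 \<subseteq> F \<and> F \<subseteq> I"
        using F0 by (auto simp: eventually_finite_subsets_at_top)
      fix F G assume "(finite F \<and> F0 \<subseteq> F \<and> F \<subseteq> I) \<and> (finite G \<and> F0 \<subseteq> G \<and> G \<subseteq> I)"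
      then have "dist (X F) (X F0) < e/2" "dist (X G) (X F0) < e/2" using near by blast+
      then show "dist (X F) (X G) < e" using dist_triangle2[of "X F" "X G" "X F0"] by linarith
    qed
  qed
  then have "cauchy_filter (filtermap X (finite_subsets_at_top I))"
    by (simp add: cauchy_filter_metric_filtermap)
  moreover have "complete (UNIV :: 'a set)"
    by (meson Cauchy_convergent UNIV_I complete_def convergent_def)
  ultimately obtain L where "(X \<longlongrightarrow> L) (finite_subsets_at_top I)"
    using complete_uniform[where S=UNIV] by (force simp add: filterlim_def)
  then show ?thesis
    unfolding X_def using summable_on_def has_sum_def by blast
qed

text \<open>For orthonormal \<open>E\<close> in a Hilbert space and the identity as
  \<open>\<phi>\<close> this is the orthogonal projection onto the closed span of \<open>E\<close>;
  for a bijection \<open>\<phi>\<close> between orthonormal bases it is the unitary operator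
  extending \<open>\<phi>\<close>.\<close>

definition expansion :: "'a::complex_inner set \<Rightarrow> ('a \<Rightarrow> 'b::complex_inner) \<Rightarrow> 'a \<Rightarrow> 'b" where
  "expansion E \<phi> x = (\<Sum>\<^sub>\<infinity>e\<in>E. cinner x e *\<^sub>C \<phi> e)"

lemma expansion_has_sum:
  fixes \<phi> :: "'a::complex_inner \<Rightarrow> 'b::chilbert_space"
  assumes "orthonormal_on E (\<lambda>e. e)" "orthonormal_on E \<phi>"
  shows "((\<lambda>e. cinner x e *\<^sub>C \<phi> e) has_sum expansion E \<phi> x) E"
  unfolding expansion_def
  using riesz_fischer[OF assms(2) square_summable_coefficients[OF assms(1)]] by simp

lemma cinner_expansion_orthogonal:
  fixes \<phi> :: "'a::complex_inner \<Rightarrow> 'b::chilbert_space"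
  assumes "orthonormal_on E (\<lambda>e. e)" "orthonormal_on E \<phi>" "\<And>e. e \<in> E \<Longrightarrow> cinner (\<phi> e) y = 0"
  shows "cinner (expansion E \<phi> x) y = 0"
proof -
  have "((\<lambda>e. cinner (cinner x e *\<^sub>C \<phi> e) y) has_sum cinner (expansion E \<phi> x) y) E"
    using has_sum_bounded_linear[OF bounded_linear_cinner_left expansion_has_sum] assms by blast
  moreover have "((\<lambda>e. cinner (cinner x e *\<^sub>C \<phi> e) y) has_sum 0) E"
    using assms(3) by (intro has_sum_0) (simp add: cinner_scaleC_left)
  ultimately show ?thesis by (rule has_sum_unique)
qed

text \<open>Continuity moves the inner product inside the sum, where only the term with index
  \<open>e\<close> survives.\<close>

lemma cinner_expansion:
  fixes \<phi> :: "'a::complex_inner \<Rightarrow> 'b::chilbert_space"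
  assumes "orthonormal_on E (\<lambda>e. e)" "orthonormal_on E \<phi>" "e \<in> E"
  shows "cinner (expansion E \<phi> x) (\<phi> e) = cinner x e"
proof -
  have "((\<lambda>d. cinner (cinner x d *\<^sub>C \<phi> d) (\<phi> e)) has_sum cinner (expansion E \<phi> x) (\<phi> e)) E"
    using has_sum_bounded_linear[OF bounded_linear_cinner_left expansion_has_sum] assms by blast
  moreover have "((\<lambda>d. cinner (cinner x d *\<^sub>C \<phi> d) (\<phi> e)) has_sum cinner x e) E \<longleftrightarrow>
      ((\<lambda>d. cinner x d) has_sum cinner x e) {e}"
    using assms by (intro has_sum_cong_neutral) (auto simp: orthonormal_on_def cinner_scaleC_left)
  moreover have "((\<lambda>d. cinner x d) has_sum cinner x e) {e}"
    using has_sum_finite[of "{e}" "\<lambda>d. cinner x d"] by simp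
  ultimately show ?thesis using has_sum_unique by blast
qed

text \<open>Linearity follows from uniqueness of sums. Bessel's inequality bounds the norm of every
  finite partial sum by that of \<open>x\<close>, so the operator is a contraction.\<close>

lemma expansion_bounded_ops:
  fixes \<phi> :: "'a::complex_inner \<Rightarrow> 'b::chilbert_space"
  assumes on: "orthonormal_on E (\<lambda>e. e)" "orthonormal_on E \<phi>"
  shows "expansion E \<phi> \<in> bounded_ops"
proof -
  note S = expansion_has_sum[OF on]
  have add: "expansion E \<phi> (x + y) = expansion E \<phi> x + expansion E \<phi> y" for x y
    using has_sum_add[OF S[of x] S[of y]] S[of "x + y"]
    by (simp add: cinner_add_left scaleC_add_left has_sum_unique)
  have scale: "expansion E \<phi> (c *\<^sub>C x) = c *\<^sub>C expansion E \<phi> x" for c x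
    using has_sum_bounded_linear[OF bounded_linear_scaleC[of c] S[of x]] S[of "c *\<^sub>C x"]
    by (simp add: cinner_scaleC_left scaleC_scaleC has_sum_unique)
  have "norm (expansion E \<phi> x) \<le> norm x * 1" for x
  proof -
    have "(sum (\<lambda>e. cinner x e *\<^sub>C \<phi> e) \<longlongrightarrow> expansion E \<phi> x) (finite_subsets_at_top E)"
      using S[of x] by (simp add: has_sum_def)
    moreover have "\<forall>\<^sub>F F in finite_subsets_at_top E.
        norm (sum (\<lambda>e. cinner x e *\<^sub>C \<phi> e) F) \<le> norm x"
    proof (rule eventually_finite_subsets_at_top_weakI)
      fix F assume F: "finite F" "F \<subseteq> E"
      then have "(norm (\<Sum>e\<in>F. cinner x e *\<^sub>C \<phi> e))\<^sup>2 \<le> (norm x)\<^sup>2"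
        using norm_orthonormal_sum[OF on(2)] bessel_inequality[OF on(1)] by simp
      then show "norm (\<Sum>e\<in>F. cinner x e *\<^sub>C \<phi> e) \<le> norm x"
        using power2_le_imp_le norm_ge_zero by blast
    qed
    ultimately show ?thesis
      using Lim_norm_ubound[of "finite_subsets_at_top E"] by simp
  qed
  then have "bounded_linear (expansion E \<phi>)"
    by (intro bounded_linear_intro[of _ 1]) (simp_all add: add scale scaleR_scaleC)
  then show ?thesis using scale by (simp add: bounded_ops_def)
qed

section \<open>Orthogonal complements\<close>

definition orth :: "'a::complex_inner set \<Rightarrow> 'a set" where
  "orth V = {x. \<forall>v\<in>V. cinner x v = 0}"

lemma csubspace_orth: "csubspace (orth V)"
  unfolding orth_def
  by (intro complex_vector.subspaceI)
    (auto simp: cinner_0_left cinner_add_left cinner_scaleC_left)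

lemma closed_orth: "closed (orth V)"
proof -
  have "orth V = (\<Inter>v\<in>V. (\<lambda>x. cinner x v) -` {0})" by (auto simp: orth_def)
  moreover have "closed ((\<lambda>x. cinner x v) -` {0})" for v :: 'a
    by (intro closed_vimage closed_singleton linear_continuous_on bounded_linear_cinner_left
        continuous_closed_vimage linear_continuous_at)
  ultimately show ?thesis by auto
qed

text \<open>Existence of the orthogonal projection. In a Hilbert space this means being a closed
  subspace, but this form passes to finite-dimensional enlargements by algebra alone.\<close>

definition orthocomplemented :: "'a::complex_inner set \<Rightarrow> bool" where
  "orthocomplemented V \<longleftrightarrow> csubspace V \<and> (\<forall>x. \<exists>v\<in>V. x - v \<in> orth V)"

lemma direct_sum_orth:
  assumes "orthocomplemented V"
  shows "direct_sum V (orth V) UNIV"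
  unfolding direct_sum_def
proof (intro conjI csubspace_orth)
  show V: "csubspace V" using assms by (simp add: orthocomplemented_def)
  show "V \<inter> orth V = {0}"
    using complex_vector.subspace_0[OF V] complex_vector.subspace_0[OF csubspace_orth[of V]]
    by (auto simp: orth_def cinner_self_eq_0)
  have "\<exists>v w. x = v + w \<and> v \<in> V \<and> w \<in> orth V" for x
  proof -
    obtain v where "v \<in> V" "x - v \<in> orth V" using assms by (auto simp: orthocomplemented_def)
    then show ?thesis by (intro exI[of _ v] exI[of _ "x - v"]) simp
  qed
  then show "UNIV = {v + w |v w. v \<in> V \<and> w \<in> orth V}" by auto
qed

text \<open>For \<open>x\<close> in the double complement with projection \<open>v\<close>, the
  vector \<open>x - v\<close> is orthogonal to \<open>x\<close> and to \<open>v\<close>, hence to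
  itself.\<close>

lemma orth_orth:
  assumes "orthocomplemented V" shows "orth (orth V) = V"
proof (intro equalityI subsetI)
  fix x assume x: "x \<in> orth (orth V)"
  obtain v where v: "v \<in> V" "x - v \<in> orth V" using assms by (auto simp: orthocomplemented_def)
  have "cinner v (x - v) = 0" using v unfolding cinner_eq_0_commute[of v] by (auto simp: orth_def)
  moreover have "cinner x (x - v) = 0" using x v by (auto simp: orth_def)
  ultimately have "cinner (x - v) (x - v) = 0" unfolding cinner_diff_left[of x v] by simp
  then have "x - v = 0" unfolding cinner_self_eq_0 .
  then show "x \<in> V" using v by simp
next
  fix x assume "x \<in> V"
  then have "cinner x w = 0" if "w \<in> orth V" for w
    using that unfolding cinner_eq_0_commute[of x w] by (simp add: orth_def)
  then show "x \<in> orth (orth V)" by (simp add: orth_def[of "orth V"])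
qed

lemma closed_orthocomplemented: "orthocomplemented V \<Longrightarrow> closed V"
  using orth_orth[of V] closed_orth[of "orth V"] by simp

lemma orthocomplemented_orth:
  assumes "orthocomplemented V" shows "orthocomplemented (orth V)"
  unfolding orthocomplemented_def orth_orth[OF assms]
proof (intro conjI csubspace_orth allI)
  fix x
  obtain v where "v \<in> V" "x - v \<in> orth V" using assms by (auto simp: orthocomplemented_def)
  then show "\<exists>w\<in>orth V. x - w \<in> V" by (intro bexI[of _ "x - v"]) simp_all
qed

lemma complemented_if_orthocomplemented:
  assumes "orthocomplemented V" shows "complemented V"
proof -
  note D = direct_sumD[OF direct_sum_orth[OF assms]]
  show ?thesis
    unfolding complemented_def
    by (intro exI[of _ "orth V"] conjI D(2) closed_orth D(4) D(5)[symmetric])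
qed

text \<open>One Gram-Schmidt step: \<open>n\<close> is the component of \<open>w\<close> orthogonal
  to \<open>V\<close>, and projecting onto \<open>V\<close> and then onto \<open>n\<close> gives the
  projection onto the enlarged space.\<close>

lemma orthocomplemented_insert:
  assumes V: "orthocomplemented V"
  shows "orthocomplemented {v + c *\<^sub>C w |v c. v \<in> V}" (is "orthocomplemented ?W")
proof -
  have sV: "csubspace V" using V by (simp add: orthocomplemented_def)
  have "{v + c *\<^sub>C w |v c. v \<in> V} = {v + u |v u. v \<in> V \<and> u \<in> cspan {w}}"
    by (auto simp: complex_vector.span_singleton)
  then have sW: "csubspace ?W" using complex_vector.subspace_sums[OF sV] by simp
  obtain p where p: "p \<in> V" "w - p \<in> orth V" using V by (auto simp: orthocomplemented_def)
  define n where "n = w - p"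
  have "\<exists>y\<in>?W. x - y \<in> orth ?W" for x
  proof -
    obtain v where v: "v \<in> V" "x - v \<in> orth V" using V by (auto simp: orthocomplemented_def)
    \<comment> \<open>If \<open>w\<close> lies in \<open>V\<close>, then \<open>n = 0\<close>, and
      division by zero gives \<open>c = 0\<close>; the orthogonality of \<open>r\<close> and
      \<open>n\<close> is then trivial.\<close>
    define c where "c = cinner (x - v) n / cinner n n"
    define r where "r = x - v - c *\<^sub>C n"
    have rV: "r \<in> orth V"
      unfolding r_def using v p csubspace_orth complex_vector.subspace_diff
        complex_vector.subspace_scale unfolding n_def by blast
    have "cinner r n = 0"
    proof (cases "n = 0")
      case False
      then show ?thesis
        using cinner_self_eq_0[of n] by (simp add: r_def cinner_diff_left cinner_scaleC_left c_def)
    qed (simp add: cinner_0_right)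
    moreover have "cinner r p = 0" using rV p by (auto simp: orth_def)
    moreover have "w = n + p" by (simp add: n_def)
    ultimately have "cinner r w = 0" by (simp add: cinner_add_right)
    then have "r \<in> orth ?W"
      using rV by (auto simp: orth_def cinner_add_right cinner_scaleC_right)
    moreover have "x - r = (v - c *\<^sub>C p) + c *\<^sub>C w"
      by (simp add: r_def n_def complex_vector.scale_right_diff_distrib)
    moreover have "v - c *\<^sub>C p \<in> V"
      using v p sV complex_vector.subspace_diff complex_vector.subspace_scale by blast
    ultimately have xr: "x - r \<in> ?W" by blast
    have "x - (x - r) = r" by simp
    then have "x - (x - r) \<in> orth ?W" using \<open>r \<in> orth ?W\<close> by (simp only:)
    then show ?thesis using xr by (rule bexI)
  qed
  then show ?thesis using sW by (simp add: orthocomplemented_def)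
qed

lemma orthocomplemented_add_finite:
  assumes "orthocomplemented V" "finite B"
  shows "orthocomplemented {v + u |v u. v \<in> V \<and> u \<in> cspan B}"
  using assms(2)
proof (induction B)
  case empty
  then show ?case using assms(1) by simp
next
  case (insert w B)
  have "{v + u |v u. v \<in> V \<and> u \<in> cspan (insert w B)} =
      {y + c *\<^sub>C w |y c. y \<in> {v + u |v u. v \<in> V \<and> u \<in> cspan B}}" (is "?L = ?R")
  proof (intro equalityI subsetI)
    fix x assume "x \<in> ?L"
    then obtain v u c where "x = v + u" "v \<in> V" "u - c *\<^sub>C w \<in> cspan B"
      by (auto simp: complex_vector.span_insert)
    then have "x = (v + (u - c *\<^sub>C w)) + c *\<^sub>C w" "v \<in> V" "u - c *\<^sub>C w \<in> cspan B"
      by simp_all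
    then show "x \<in> ?R" by blast
  next
    fix x assume "x \<in> ?R"
    then obtain v u c where "x = v + u + c *\<^sub>C w" "v \<in> V" "u \<in> cspan B" by blast
    moreover have "u + c *\<^sub>C w \<in> cspan (insert w B)"
      using subsetD[OF complex_vector.span_mono[OF subset_insertI] \<open>u \<in> cspan B\<close>]
        complex_vector.span_base[of w "insert w B"]
      by (simp add: complex_vector.span_add complex_vector.span_scale)
    ultimately have "x = v + (u + c *\<^sub>C w)" "v \<in> V" "u + c *\<^sub>C w \<in> cspan (insert w B)"
      by (simp_all add: add.assoc)
    then show "x \<in> ?L" by blast
  qed
  then show ?case using orthocomplemented_insert[OF insert.IH] by simp
qed

lemma orthocomplemented_0: "orthocomplemented {0}"
  by (simp add: orthocomplemented_def orth_def cinner_0_right)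

lemma orthocomplemented_finite_dim:
  assumes "cdimension V < \<infinity>" shows "orthocomplemented V"
proof -
  obtain B where "finite B" "cspan B = V" using assms cdimension_finiteD by blast
  then show ?thesis using orthocomplemented_add_finite[OF orthocomplemented_0, of B] by simp
qed

section \<open>Orthonormal bases\<close>

text \<open>Completeness is expressed as maximality inside \<open>V\<close>, which Zorn's lemma
  provides directly. For closed \<open>V\<close> in a Hilbert space this is an orthonormal basis in
  the usual sense.\<close>

definition onb :: "'a::complex_inner set \<Rightarrow> 'a set \<Rightarrow> bool" where
  "onb V E \<longleftrightarrow> E \<subseteq> V \<and> orthonormal_on E (\<lambda>e. e) \<and>
    (\<forall>x\<in>V. (\<forall>e\<in>E. cinner x e = 0) \<longrightarrow> x = 0)"

text \<open>Zorn's lemma gives a maximal orthonormal subset of \<open>V\<close>; a nonzero vector of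
  \<open>V\<close> orthogonal to it could be normalised and added.\<close>

lemma onb_exists:
  assumes V: "csubspace V" shows "\<exists>E. onb V E"
proof -
  define \<A> where "\<A> = {E. E \<subseteq> V \<and> orthonormal_on E (\<lambda>e. e)}"
  have "\<exists>M\<in>\<A>. \<forall>X\<in>\<A>. M \<subseteq> X \<longrightarrow> X = M"
  proof (rule subset_Zorn')
    fix \<C> assume C: "subset.chain \<A> \<C>"
    then have CA: "\<And>X. X \<in> \<C> \<Longrightarrow> X \<subseteq> V \<and> orthonormal_on X (\<lambda>e. e)"
      by (auto simp: subset.chain_def \<A>_def)
    have "cinner e f = (if e = f then 1 else 0)" if ef: "e \<in> \<Union>\<C>" "f \<in> \<Union>\<C>" for e f
    proof -
      obtain X Y where XY: "X \<in> \<C>" "Y \<in> \<C>" "e \<in> X" "f \<in> Y" using ef by blast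
      then have "X \<subseteq> Y \<or> Y \<subseteq> X" using C by (auto simp: subset.chain_def)
      then obtain Z where "Z \<in> \<C>" "e \<in> Z" "f \<in> Z" using XY by blast
      then show ?thesis using CA[of Z] by (simp add: orthonormal_on_def)
    qed
    then show "\<Union>\<C> \<in> \<A>" using CA by (auto simp: \<A>_def orthonormal_on_def)
  qed
  then obtain E where E: "E \<subseteq> V" "orthonormal_on E (\<lambda>e. e)"
    and max: "\<And>X. X \<subseteq> V \<Longrightarrow> orthonormal_on X (\<lambda>e. e) \<Longrightarrow> E \<subseteq> X \<Longrightarrow> X = E"
    by (auto simp: \<A>_def)
  have "x = 0" if x: "x \<in> V" "\<forall>e\<in>E. cinner x e = 0" for x
  proof (rule ccontr)
    assume "x \<noteq> 0"
    define c where "c = complex_of_real (inverse (norm x))"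
    define u where "u = c *\<^sub>C x"
    have "norm u = 1" using \<open>x \<noteq> 0\<close> by (simp add: u_def c_def norm_scaleC norm_inverse)
    then have uu: "cinner u u = 1" by (simp add: cinner_eq_norm)
    have ue: "cinner u e = 0" if "e \<in> E" for e
      using that x by (simp add: u_def cinner_scaleC_left)
    then have eu: "cinner e u = 0" if "e \<in> E" for e
      using that unfolding cinner_eq_0_commute[of e u] by simp
    have "u \<notin> E" using ue uu by force
    have "u \<in> V" unfolding u_def using x V complex_vector.subspace_scale by blast
    moreover have "orthonormal_on (insert u E) (\<lambda>e. e)"
      using E(2) uu ue eu \<open>u \<notin> E\<close> by (auto simp: orthonormal_on_def)
    ultimately have "insert u E = E" using max E(1) by blast
    then show False using \<open>u \<notin> E\<close> by blast
  qed
  then show ?thesis using E by (auto simp: onb_def)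
qed

lemma orthonormal_independent:
  assumes E: "orthonormal_on E (\<lambda>e. e)" shows "cindependent E"
  unfolding complex_vector.independent_explicit_finite_subsets
proof (intro allI impI ballI)
  fix F :: "'a set" and u v
  assume F: "F \<subseteq> E" "finite F" "(\<Sum>v\<in>F. u v *\<^sub>C v) = 0" "v \<in> F"
  then have "u v = cinner (\<Sum>v\<in>F. u v *\<^sub>C v) v"
    using cinner_orthonormal_sum[OF E F(2,1), of v u] by auto
  then show "u v = 0" using F(3) by (simp add: cinner_0_left)
qed

text \<open>If \<open>E\<close> is finite, then \<open>x\<close> minus its expansion lies in
  \<open>V\<close> and is orthogonal to \<open>E\<close>, so \<open>E\<close> spans
  \<open>V\<close>. If \<open>E\<close> is infinite, its span is already
  infinite-dimensional.\<close>

lemma onb_cdimension: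
  assumes V: "csubspace V" and E: "onb V E"
  shows "cdimension V = (if finite E then enat (card E) else \<infinity>)"
proof -
  have E': "E \<subseteq> V" "orthonormal_on E (\<lambda>e. e)" using E by (auto simp: onb_def)
  have EV: "cspan E \<subseteq> V" using complex_vector.span_minimal[OF E'(1) V] .
  show ?thesis
  proof (cases "finite E")
    case True
    have "x \<in> cspan E" if x: "x \<in> V" for x
    proof -
      define s where "s = (\<Sum>e\<in>E. cinner x e *\<^sub>C e)"
      have s: "s \<in> cspan E" unfolding s_def
        by (intro complex_vector.span_sum complex_vector.span_scale complex_vector.span_base)
      have "cinner (x - s) e = 0" if "e \<in> E" for e
        using cinner_orthonormal_sum[OF E'(2) True subset_refl that, of "cinner x"] that
        by (simp add: cinner_diff_left s_def)
      moreover have "x - s \<in> V" using x s EV V complex_vector.subspace_diff by blast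
      ultimately have "x - s = 0" using E unfolding onb_def by blast
      then show ?thesis using s by simp
    qed
    then have "cspan E = V" using EV by blast
    then show ?thesis
      using cdimension_span_independent[OF orthonormal_independent[OF E'(2)]] by simp
  next
    case False
    then have "cdimension (cspan E) = \<infinity>"
      using cdimension_span_independent[OF orthonormal_independent[OF E'(2)]] by simp
    then show ?thesis
      using cdimension_mono[OF complex_vector.subspace_span V EV] False by simp
  qed
qed

lemma onb_expansion:
  fixes E :: "'a::chilbert_space set"
  assumes V: "csubspace V" "closed V" and E: "onb V E"
  shows "expansion E (\<lambda>e. e) x \<in> V" "x \<in> V \<Longrightarrow> expansion E (\<lambda>e. e) x = x"
proof -
  have E': "E \<subseteq> V" "orthonormal_on E (\<lambda>e. e)" using E by (auto simp: onb_def)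
  have in_V: "expansion E (\<lambda>e. e) x \<in> V" for x
  proof (rule Lim_in_closed_set[OF V(2)])
    show "(sum (\<lambda>e. cinner x e *\<^sub>C e) \<longlongrightarrow> expansion E (\<lambda>e. e) x) (finite_subsets_at_top E)"
      using expansion_has_sum[OF E'(2) E'(2)] by (simp add: has_sum_def)
    show "\<forall>\<^sub>F F in finite_subsets_at_top E. sum (\<lambda>e. cinner x e *\<^sub>C e) F \<in> V"
      using E'(1) by (intro eventually_finite_subsets_at_top_weakI complex_vector.subspace_sum
          complex_vector.subspace_scale V(1)) auto
  qed simp
  show "expansion E (\<lambda>e. e) x \<in> V" by (rule in_V)
  assume x: "x \<in> V"
  have "cinner (x - expansion E (\<lambda>e. e) x) e = 0" if "e \<in> E" for e
    using cinner_expansion[OF E'(2) E'(2) that] by (simp add: cinner_diff_left)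
  moreover have "x - expansion E (\<lambda>e. e) x \<in> V"
    using x in_V V(1) complex_vector.subspace_diff by blast
  ultimately have "x - expansion E (\<lambda>e. e) x = 0" using E unfolding onb_def by blast
  then show "expansion E (\<lambda>e. e) x = x" by simp
qed

text \<open>The projection theorem: the expansion of \<open>x\<close> in an orthonormal basis of
  \<open>V\<close> is the projection. The vector \<open>x - s\<close> is orthogonal to the basis,
  hence to all expansions, and these exhaust \<open>V\<close>.\<close>

lemma orthocomplemented_closed:
  fixes V :: "'a::chilbert_space set"
  assumes V: "csubspace V" "closed V"
  shows "orthocomplemented V"
  unfolding orthocomplemented_def
proof (intro conjI V(1) allI)
  fix x
  obtain E where E: "onb V E" using onb_exists[OF V(1)] ..
  have E': "E \<subseteq> V" "orthonormal_on E (\<lambda>e. e)" using E by (auto simp: onb_def)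
  define s where "s = expansion E (\<lambda>e. e) x"
  have "cinner e (x - s) = 0" if "e \<in> E" for e
    unfolding cinner_eq_0_commute[of e] using cinner_expansion[OF E'(2) E'(2) that, of x]
    by (simp add: cinner_diff_left s_def)
  then have "cinner (expansion E (\<lambda>e. e) v) (x - s) = 0" for v
    using cinner_expansion_orthogonal[OF E'(2) E'(2)] by blast
  then have "cinner (x - s) v = 0" if "v \<in> V" for v
    unfolding cinner_eq_0_commute[of _ v] using onb_expansion(2)[OF V E that] by metis
  then have "x - s \<in> orth V" by (simp add: orth_def)
  moreover have "s \<in> V" unfolding s_def by (rule onb_expansion(1)[OF V E])
  ultimately show "\<exists>v\<in>V. x - v \<in> orth V" by blast
qed

text \<open>Distinct orthonormal vectors have squared distance 2, so a choice of points of the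
  countable dense set within 1/2 of them is injective.\<close>

lemma orthonormal_countable:
  fixes E :: "'a::complex_inner set"
  assumes "separable (UNIV :: 'a set)" and E: "orthonormal_on E (\<lambda>e. e)"
  shows "countable E"
proof -
  obtain D :: "'a set" where D: "countable D" "closure D = UNIV"
    using assms(1) by (auto simp: separable_def)
  have "\<exists>d\<in>D. dist d e < 1/2" for e
    using D(2) half_gt_zero[OF zero_less_one] unfolding closure_approachable[of e D, symmetric] 
    by (metis UNIV_I closure_approachable)
  then obtain d where d: "\<And>e. d e \<in> D" "\<And>e. dist (d e) e < 1/2" by metis
  have "inj_on d E"
  proof (rule inj_onI, rule ccontr)
    fix e f assume ef: "e \<in> E" "f \<in> E" "d e = d f" "e \<noteq> f"
    have ip: "inner e e = 1" "inner f f = 1" "inner e f = 0"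
      using E ef by (auto simp: orthonormal_on_def inner_eq_Re_cinner)
    have "(dist e f)\<^sup>2 = 2"
      by (simp add: dist_norm power2_norm_eq_inner inner_diff_left inner_diff_right ip
          inner_commute[of f e])
    moreover have "dist e f < 1"
      using d(2)[of e] d(2)[of f] dist_triangle3[of e f "d e"] ef(3) by simp
    then have "(dist e f)\<^sup>2 < 1\<^sup>2" by (intro power_strict_mono) auto
    ultimately show False by simp
  qed
  moreover have "countable (d ` E)" using d(1) D(1) by (meson countable_subset image_subsetI)
  ultimately show ?thesis using countable_image_inj_on by blast
qed

section \<open>Invertible operators with prescribed image of a subspace\<close>

text \<open>The description of \<open>V\<close> by vanishing \<open>F\<close>-coordinates is what
  later lets membership in \<open>V\<close> be tested on coordinates.\<close>

lemma onb_Un_orth: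
  assumes V: "orthocomplemented V" and E: "onb V E" and F: "onb (orth V) F"
  shows "onb UNIV (E \<union> F)" "E \<inter> F = {}" "V = {x. \<forall>f\<in>F. cinner x f = 0}"
proof -
  have E': "E \<subseteq> V" "orthonormal_on E (\<lambda>e. e)" using E by (auto simp: onb_def)
  have F': "F \<subseteq> orth V" "orthonormal_on F (\<lambda>e. e)" using F by (auto simp: onb_def)
  have perp: "cinner x y = 0" "cinner y x = 0" if "x \<in> V" "y \<in> orth V" for x y
    using that unfolding cinner_eq_0_commute[of x y] by (auto simp: orth_def)
  have EF: "cinner e f = 0" "cinner f e = 0" if "e \<in> E" "f \<in> F" for e f
    using perp[of e f] that E'(1) F'(1) by auto
  show disj: "E \<inter> F = {}"
  proof (rule ccontr)
    assume "E \<inter> F \<noteq> {}"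
    then obtain e where "e \<in> E" "e \<in> F" by blast
    then show False using EF[of e e] E'(2) by (simp add: orthonormal_on_def)
  qed
  have in_V: "x \<in> V" if x: "\<forall>f\<in>F. cinner x f = 0" for x
  proof -
    obtain v where v: "v \<in> V" "x - v \<in> orth V" using V by (auto simp: orthocomplemented_def)
    have "cinner (x - v) f = 0" if "f \<in> F" for f
      using x that perp(1)[OF v(1)] F'(1) by (auto simp: cinner_diff_left)
    then have "x - v = 0" using F v unfolding onb_def by blast
    then show ?thesis using v by simp
  qed
  then show "V = {x. \<forall>f\<in>F. cinner x f = 0}" using perp F'(1) by blast
  have "orthonormal_on (E \<union> F) (\<lambda>e. e)"
    using E'(2) F'(2) EF disj by (auto simp: orthonormal_on_def)
  moreover have "x = 0" if x: "\<forall>e\<in>E \<union> F. cinner x e = 0" for x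
  proof -
    have "x \<in> V" using in_V x by blast
    then show ?thesis using E x unfolding onb_def by blast
  qed
  ultimately show "onb UNIV (E \<union> F)" by (simp add: onb_def)
qed

lemma orthonormal_on_bij_betw:
  assumes \<phi>: "bij_betw \<phi> E F" and F: "orthonormal_on F (\<lambda>e. e)"
  shows "orthonormal_on E \<phi>"
  unfolding orthonormal_on_def
proof (intro ballI)
  fix i j assume ij: "i \<in> E" "j \<in> E"
  then have "\<phi> i \<in> F" "\<phi> j \<in> F" "\<phi> i = \<phi> j \<longleftrightarrow> i = j"
    using \<phi> by (auto simp: bij_betw_def inj_on_eq_iff)
  then show "cinner (\<phi> i) (\<phi> j) = (if i = j then 1 else 0)"
    using F by (simp add: orthonormal_on_def)
qed

text \<open>Expanding forth and back restores every coordinate with respect to \<open>E\<close>, and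
  a vector with zero coordinates vanishes.\<close>

lemma expansion_inverse:
  fixes E :: "'a::chilbert_space set" and F :: "'b::chilbert_space set"
  assumes E: "onb UNIV E" and F: "onb UNIV F" and \<phi>: "bij_betw \<phi> E F"
  shows "expansion F (inv_into E \<phi>) (expansion E \<phi> x) = x"
proof -
  have E': "orthonormal_on E (\<lambda>e. e)" using E by (auto simp: onb_def)
  have F': "orthonormal_on F (\<lambda>e. e)" using F by (auto simp: onb_def)
  have \<phi>': "orthonormal_on E \<phi>"
    by (rule orthonormal_on_bij_betw[OF \<phi> F'])
  have \<psi>: "bij_betw (inv_into E \<phi>) F E" using \<phi> by (rule bij_betw_inv_into)
  have \<psi>': "orthonormal_on F (inv_into E \<phi>)"
    by (rule orthonormal_on_bij_betw[OF \<psi> E'])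
  have "cinner (expansion F (inv_into E \<phi>) (expansion E \<phi> x) - x) e = 0" if e: "e \<in> E" for e
  proof -
    have "\<phi> e \<in> F" "inv_into E \<phi> (\<phi> e) = e"
      using e \<phi> by (auto simp: bij_betw_def)
    then show ?thesis
      using cinner_expansion[OF F' \<psi>', of "\<phi> e" "expansion E \<phi> x"] cinner_expansion[OF E' \<phi>' e]
      by (simp add: cinner_diff_left)
  qed
  then have "expansion F (inv_into E \<phi>) (expansion E \<phi> x) - x = 0"
    using E unfolding onb_def by blast
  then show ?thesis by simp
qed

text \<open>Bases of \<open>V\<close> and \<open>W\<close>, and of their orthogonal complements, are
  matched by bijections; the combined bijection extends to a unitary operator.\<close>

lemma invertible_op_subspace_onto:
  fixes V :: "'a::chilbert_space set" and W :: "'b::chilbert_space set"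
  assumes sep: "separable (UNIV :: 'a set)" "separable (UNIV :: 'b set)"
    and V: "orthocomplemented V" and W: "orthocomplemented W"
    and dim: "cdimension V = cdimension W"
    and inf: "cdimension (orth V) = \<infinity>" "cdimension (orth W) = \<infinity>"
  shows "\<exists>C \<in> invertible_ops. C ` V = W"
proof -
  have sV: "csubspace V" and sW: "csubspace W" using V W by (auto simp: orthocomplemented_def)
  obtain E1 where E1: "onb V E1" using onb_exists[OF sV] ..
  obtain E2 where E2: "onb (orth V) E2" using onb_exists[OF csubspace_orth] ..
  obtain F1 where F1: "onb W F1" using onb_exists[OF sW] ..
  obtain F2 where F2: "onb (orth W) F2" using onb_exists[OF csubspace_orth] ..
  have cnt: "countable E1" "countable E2" "countable F1" "countable F2"
    using E1 E2 F1 F2 orthonormal_countable sep by (auto simp: onb_def)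
  \<comment> \<open>An infinite \<open>enat\<close> dimension does not determine a cardinality;
    countability, from separability, makes infinite bases equipotent.\<close>
  have bij: "\<exists>g. bij_betw g X Y" if "countable X" "countable Y"
    "(finite X \<and> finite Y \<and> card X = card Y) \<or> (infinite X \<and> infinite Y)"
    for X :: "'a set" and Y :: "'b set"
    using that(3)
  proof
    assume "finite X \<and> finite Y \<and> card X = card Y"
    then show ?thesis using finite_same_card_bij by blast
  next
    assume "infinite X \<and> infinite Y"
    then show ?thesis
      using that(1,2) by (meson bij_betw_from_nat_into bij_betw_trans to_nat_on_infinite)
  qed
  obtain g1 where g1: "bij_betw g1 E1 F1"
    using bij[OF cnt(1,3)] dim onb_cdimension[OF sV E1] onb_cdimension[OF sW F1]
    by (auto split: if_splits)
  obtain g2 where g2: "bij_betw g2 E2 F2"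
    using bij[OF cnt(2,4)] inf onb_cdimension[OF csubspace_orth E2]
      onb_cdimension[OF csubspace_orth F2] by (auto split: if_splits)
  note E = onb_Un_orth[OF V E1 E2] and F = onb_Un_orth[OF W F1 F2]
  define \<phi> where "\<phi> = (\<lambda>e. if e \<in> E1 then g1 e else g2 e)"
  have \<phi>1: "bij_betw \<phi> E1 F1"
    using g1 by (rule bij_betw_cong[THEN iffD1, rotated]) (simp add: \<phi>_def)
  have \<phi>2: "bij_betw \<phi> E2 F2"
    using g2 by (rule bij_betw_cong[THEN iffD1, rotated]) (use E(2) in \<open>auto simp: \<phi>_def\<close>)
  have \<phi>: "bij_betw \<phi> (E1 \<union> E2) (F1 \<union> F2)"
    using bij_betw_combine[OF \<phi>1 \<phi>2 F(2)] .
  define \<psi> where "\<psi> = inv_into (E1 \<union> E2) \<phi>"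
  have \<psi>: "bij_betw \<psi> (F1 \<union> F2) (E1 \<union> E2)" unfolding \<psi>_def using \<phi> by (rule bij_betw_inv_into)
  define C where "C = expansion (E1 \<union> E2) \<phi>"
  define D where "D = expansion (F1 \<union> F2) \<psi>"
  have oE: "orthonormal_on (E1 \<union> E2) (\<lambda>e. e)" and oF: "orthonormal_on (F1 \<union> F2) (\<lambda>e. e)"
    using E(1) F(1) by (auto simp: onb_def)
  have o\<phi>: "orthonormal_on (E1 \<union> E2) \<phi>"
    by (rule orthonormal_on_bij_betw[OF \<phi> oF])
  have o\<psi>: "orthonormal_on (F1 \<union> F2) \<psi>"
    by (rule orthonormal_on_bij_betw[OF \<psi> oE])
  have DC: "D (C x) = x" for x
    unfolding C_def D_def \<psi>_def by (rule expansion_inverse[OF E(1) F(1) \<phi>])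
  \<comment> \<open>The inverse of \<open>\<psi>\<close> is known to agree with
    \<open>\<phi>\<close> only on \<open>E1 \<union> E2\<close>, so the equality is proved for the
    expansions instead of the functions.\<close>
  have inv\<psi>: "expansion (E1 \<union> E2) (inv_into (F1 \<union> F2) \<psi>) = C"
  proof
    fix x
    have "inv_into (F1 \<union> F2) \<psi> e = \<phi> e" if "e \<in> E1 \<union> E2" for e
      unfolding \<psi>_def by (rule inv_into_inv_into_eq[OF \<phi> that])
    then show "expansion (E1 \<union> E2) (inv_into (F1 \<union> F2) \<psi>) x = C x"
      unfolding C_def expansion_def by (intro infsum_cong) simp
  qed
  have CD: "C (D y) = y" for y
    using expansion_inverse[OF F(1) E(1) \<psi>, of y] unfolding inv\<psi> D_def .
  have "C \<in> bounded_ops" "D \<in> bounded_ops"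
    unfolding C_def D_def by (rule expansion_bounded_ops[OF oE o\<phi>] expansion_bounded_ops[OF oF o\<psi>])+
  then have inv: "C \<in> invertible_ops"
    unfolding invertible_ops_def using CD DC by (auto simp: fun_eq_iff intro!: bexI[of _ D])
  \<comment> \<open>\<open>C\<close> turns the \<open>E2\<close>-coordinates of \<open>x\<close>
    into the \<open>F2\<close>-coordinates of \<open>C x\<close>, and their vanishing characterises
    \<open>V\<close> and \<open>W\<close>.\<close>
  have iff: "x \<in> V \<longleftrightarrow> C x \<in> W" for x
  proof -
    have "cinner (C x) (\<phi> e) = cinner x e" if "e \<in> E2" for e
      unfolding C_def using cinner_expansion[OF oE o\<phi>, of e x] that by simp
    moreover have "F2 = \<phi> ` E2" using \<phi>2 by (simp add: bij_betw_def)
    ultimately have "(\<forall>f\<in>F2. cinner (C x) f = 0) \<longleftrightarrow> (\<forall>e\<in>E2. cinner x e = 0)" by simp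
    then show ?thesis using E(3) F(3) by blast
  qed
  have "C ` V = W"
  proof (intro equalityI subsetI)
    fix y assume "y \<in> W"
    then have "D y \<in> V" using iff[of "D y"] CD by simp
    then show "y \<in> C ` V" using CD by (metis imageI)
  qed (use iff in blast)
  then show ?thesis using inv by blast
qed

section \<open>Open mapping\<close>

text \<open>By Baire's theorem the closed image \<open>K n\<close> of some ball contains a ball
  around \<open>y0\<close>. Subtracting approximate preimages of two of its points and rescaling
  gives an approximate preimage of any \<open>y\<close>.\<close>

lemma bounded_linear_onto_approximate_preimage:
  fixes T :: "'a::banach \<Rightarrow> 'b::banach"
  assumes T: "bounded_linear T" and S: "subspace S" and onto: "T ` S = UNIV"
  obtains k where "k \<ge> 0"
    "\<And>y e. e > 0 \<Longrightarrow> \<exists>x\<in>S. norm x \<le> k * norm y \<and> norm (y - T x) < e"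
proof -
  define K where "K n = closure (T ` (S \<inter> cball 0 (real n)))" for n
  have "\<exists>n. interior (K n) \<noteq> {}"
  proof (rule ccontr)
    assume "\<not> ?thesis"
    then have "Met_TC.mtopology interior_of \<Union>(range K) = {}"
      by (intro Met_TC.metric_Baire_category_alt) (auto simp: K_def complete_UNIV)
    moreover have "\<Union>(range K) = UNIV"
    proof -
      have "y \<in> \<Union>(range K)" for y
      proof -
        obtain x where x: "x \<in> S" "T x = y" using onto by (metis UNIV_I imageE)
        obtain n where "norm x \<le> real n" using real_arch_simple by blast
        then have "y \<in> K n" unfolding K_def using x closure_subset by fastforce
        then show ?thesis by blast
      qed
      then show ?thesis by blast
    qed
    ultimately show False by simp
  qed
  then obtain n y0 where "y0 \<in> interior (K n)" by blast
  then obtain r where r: "r > 0" "ball y0 r \<subseteq> K n" by (auto simp: mem_interior)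
  have "\<exists>x\<in>S. norm x \<le> (4 * real n / r) * norm y \<and> norm (y - T x) < e" if e: "e > 0" for y e
  proof (cases "y = 0")
    case True
    then show ?thesis
      using e subspace_0[OF S] linear_0[OF bounded_linear.linear[OF T]]
      by (intro bexI[of _ 0]) auto
  next
    case False
    \<comment> \<open>Chosen so that \<open>y0 + t *\<^sub>R y\<close> is at distance
      \<open>r / 2\<close> from \<open>y0\<close>.\<close>
    define t where "t = r / (2 * norm y)"
    have t: "t > 0" using False r by (simp add: t_def)
    have "y0 + t *\<^sub>R y \<in> ball y0 r" "y0 \<in> ball y0 r"
      using False r by (simp_all add: dist_norm t_def)
    then have K: "y0 + t *\<^sub>R y \<in> K n" "y0 \<in> K n" using r by blast+
    have te: "t * e / 2 > 0" using t e by simp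
    obtain a where a: "a \<in> S" "norm a \<le> real n" "dist (T a) (y0 + t *\<^sub>R y) < t * e / 2"
      using K(1) te unfolding K_def closure_approachable by fastforce
    obtain b where b: "b \<in> S" "norm b \<le> real n" "dist (T b) y0 < t * e / 2"
      using K(2) te unfolding K_def closure_approachable by fastforce
    define x where "x = (1 / t) *\<^sub>R (a - b)"
    have "x \<in> S" unfolding x_def using a b S by (intro subspace_scale subspace_diff)
    moreover have "norm x \<le> (4 * real n / r) * norm y"
    proof -
      have "norm (a - b) \<le> 2 * real n" using a b norm_triangle_ineq4[of a b] by simp
      then have "norm x \<le> (1 / t) * (2 * real n)"
        unfolding x_def using t by (simp add: divide_right_mono)
      also have "\<dots> = (4 * real n / r) * norm y" using False r by (simp add: t_def field_simps)
      finally show ?thesis .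
    qed
    moreover have "norm (y - T x) < e"
    proof -
      have "T x = (1 / t) *\<^sub>R (T a - T b)"
        unfolding x_def using bounded_linear.linear[OF T] by (simp add: linear_scale linear_diff)
      then have "t *\<^sub>R T x = T a - T b" using t by simp
      then have "t *\<^sub>R (y - T x) = (T b - y0) - (T a - (y0 + t *\<^sub>R y))"
        by (simp add: scaleR_diff_right)
      also have "norm \<dots> < t * e / 2 + t * e / 2"
        using a(3) b(3) norm_triangle_ineq4[of "T b - y0" "T a - (y0 + t *\<^sub>R y)"]
        unfolding dist_norm by linarith
      finally have "t * norm (y - T x) < t * e" using t by simp
      then show ?thesis using t by simp
    qed
    ultimately show ?thesis by blast
  qed
  then show thesis using r by (intro that[of "4 * real n / r"]) auto
qed

text \<open>Successive approximation: the residual is preimaged again with halved error, and the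
  resulting series converges in the closed subspace \<open>S\<close>.\<close>

lemma bounded_linear_onto_preimage:
  fixes T :: "'a::banach \<Rightarrow> 'b::banach"
  assumes T: "bounded_linear T" and S: "subspace S" "closed S" and onto: "T ` S = UNIV"
  obtains c where "c > 0" "\<And>y. \<exists>x\<in>S. T x = y \<and> norm x \<le> c * norm y"
proof -
  obtain k where k: "k \<ge> 0"
    "\<And>y e. e > 0 \<Longrightarrow> \<exists>x\<in>S. norm x \<le> k * norm y \<and> norm (y - T x) < e"
    using bounded_linear_onto_approximate_preimage[OF T S(1) onto] by metis
  define f where "f y e = (SOME x. x \<in> S \<and> norm x \<le> k * norm y \<and> norm (y - T x) < e)" for y e
  have f: "f y e \<in> S \<and> norm (f y e) \<le> k * norm y \<and> norm (y - T (f y e)) < e"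
    if "e > 0" for y e
    unfolding f_def by (rule someI_ex) (use k(2)[OF that] in blast)
  \<comment> \<open>The geometric series costs a factor 2; the added 1 keeps the constant positive
    when \<open>k = 0\<close>.\<close>
  have "\<exists>x\<in>S. T x = y \<and> norm x \<le> (2 * k + 1) * norm y" for y
  proof (cases "y = 0")
    case True
    then show ?thesis
      using subspace_0[OF S(1)] linear_0[OF bounded_linear.linear[OF T]]
      by (intro bexI[of _ 0]) auto
  next
    case False
    define e where "e = (\<lambda>n::nat. norm y * (1/2) ^ n)"
    have e: "e n > 0" for n using False by (simp add: e_def)
    \<comment> \<open>\<open>z n\<close> is the residual after \<open>n\<close> corrections, and
      \<open>x n\<close> below is the next correction.\<close>
    define z where "z = rec_nat y (\<lambda>n z. z - T (f z (e (Suc n))))"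
    define x where "x = (\<lambda>n. f (z n) (e (Suc n)))"
    have z0: "z 0 = y" and zS: "\<And>n. z (Suc n) = z n - T (x n)" by (simp_all add: z_def x_def)
    have xS: "x n \<in> S" "norm (x n) \<le> k * norm (z n)" "norm (z (Suc n)) < e (Suc n)" for n
      using f[OF e, of "z n" "Suc n"] by (simp_all add: zS x_def)
    have ze: "norm (z n) \<le> e n" for n
      using xS(3) by (cases n) (auto simp: z0 e_def less_imp_le)
    have xe: "norm (x n) \<le> k * e n" for n
      using xS(2)[of n] mult_left_mono[OF ze[of n] k(1)] by linarith
    have es: "e sums (2 * norm y)"
      using sums_mult[OF geometric_sums[of "1/2 :: real"], of "norm y"]
      by (simp add: e_def mult.commute)
    then have ks: "(\<lambda>n. k * e n) sums (k * (2 * norm y))" by (rule sums_mult)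
    have sx: "summable (\<lambda>n. norm (x n))"
      using summable_comparison_test'[OF sums_summable[OF ks], of 0 "\<lambda>n. norm (x n)"] xe by simp
    define s where "s = suminf x"
    have xs: "x sums s" unfolding s_def using summable_norm_cancel[OF sx] by (rule summable_sums)
    have "s \<in> S"
    proof (rule closed_sequentially[OF S(2)])
      show "(\<lambda>n. \<Sum>i<n. x i) \<longlonglongrightarrow> s" using xs by (simp add: sums_def)
      show "\<And>n. (\<Sum>i<n. x i) \<in> S" using xS(1) S(1) by (intro subspace_sum) auto
    qed
    moreover have "T s = y"
    proof -
      have "(\<lambda>n. T (x n)) sums T s" using bounded_linear.sums[OF T xs] .
      moreover have "(\<lambda>n. z n - z (Suc n)) sums (z 0 - 0)"
      proof (rule telescope_sums')
        have "e \<longlonglongrightarrow> 0" using summable_LIMSEQ_zero[OF sums_summable[OF es]] .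
        then show "z \<longlonglongrightarrow> 0" using ze
          by (intro Lim_null_comparison[of z e]) auto
      qed
      ultimately show ?thesis using sums_unique2 by (simp add: zS z0) blast
    qed
    moreover have "norm s \<le> (2 * k + 1) * norm y"
    proof -
      have "norm s \<le> (\<Sum>n. norm (x n))" unfolding s_def using sx by (rule summable_norm)
      also have "\<dots> \<le> (\<Sum>n. k * e n)" using xe sx sums_summable[OF ks] by (rule suminf_le)
      also have "\<dots> = k * (2 * norm y)" using sums_unique[OF ks] by simp
      also have "\<dots> \<le> (2 * k + 1) * norm y" by (simp add: algebra_simps)
      finally show ?thesis .
    qed
    ultimately show ?thesis by blast
  qed
  then show thesis using k(1) by (intro that[of "2 * k + 1"]) auto
qed

lemma bounded_ops_clinear: "T \<in> bounded_ops \<Longrightarrow> clinear T"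
  by (auto simp: bounded_ops_def clinear_iff linear_add bounded_linear.linear)

lemma csubspace_imp_subspace:
  assumes "csubspace V" shows "subspace V"
  by (rule subspaceI)
    (simp_all add: complex_vector.subspace_0[OF assms] complex_vector.subspace_add[OF assms]
      scaleR_scaleC complex_vector.subspace_scale[OF assms])

text \<open>A finite-dimensional complement \<open>F\<close> of the range makes \<open>G\<close>,
  which adds the \<open>F\<close> component to the image under \<open>T\<close>, surjective with
  controlled preimages. Points near \<open>y\<close> then have \<open>G\<close>-preimages near that
  of \<open>y\<close>, and \<open>ker T \<subseteq> V\<close> lets membership in \<open>V\<close> be
  decided on any preimage.\<close>

lemma closed_image_finite_defect:
  fixes T :: "'a::chilbert_space \<Rightarrow> 'b::chilbert_space"
  assumes T: "T \<in> bounded_ops" and fin: "defect T < \<infinity>"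
    and V: "csubspace V" "closed V" and kerV: "ker T \<subseteq> V"
  shows "closed (T ` V)"
proof -
  have bl: "bounded_linear T" and cl: "clinear T"
    using T bounded_ops_clinear by (auto simp: bounded_ops_def)
  obtain F where F: "direct_sum (range T) F UNIV"
    using direct_sum_complement[OF csubspace_range[OF cl]] ..
  have FF: "csubspace F" "closed F"
    using direct_sumD(2)[OF F] orthocomplemented_finite_dim[of F] closed_orthocomplemented[of F]
      codimension_eq_cdimension[OF F] fin by (auto simp: defect_def)
  define G where "G = (\<lambda>z. T (fst z) + snd z :: 'b)"
  have G: "bounded_linear G"
    unfolding G_def
    by (intro bounded_linear_add bounded_linear_compose[OF bl] bounded_linear_fst
        bounded_linear_snd)
  have "subspace (UNIV \<times> F :: ('a \<times> 'b) set)" "closed (UNIV \<times> F :: ('a \<times> 'b) set)"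
    using csubspace_imp_subspace[OF FF(1)] FF(2) by (auto simp: subspace_Times closed_Times)
  moreover have "G ` (UNIV \<times> F) = UNIV"
  proof -
    have "y \<in> G ` (UNIV \<times> F)" for y
    proof -
      obtain u f where "u \<in> range T" "f \<in> F" "y = u + f"
        using direct_sum_decompose[OF F UNIV_I] .
      then show ?thesis unfolding G_def by force
    qed
    then show ?thesis by blast
  qed
  ultimately obtain c where c: "c > 0" "\<And>y. \<exists>z\<in>UNIV \<times> F. G z = y \<and> norm z \<le> c * norm y"
    using bounded_linear_onto_preimage[OF G] by metis
  have "open (- (T ` V))"
    unfolding open_dist
  proof (intro ballI)
    fix y assume y: "y \<in> - (T ` V)"
    obtain u f where uf: "u \<in> range T" "f \<in> F" "y = u + f"
      using direct_sum_decompose[OF F UNIV_I] .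
    then obtain x where x: "y = T x + f" by blast
    \<comment> \<open>\<open>T x + f\<close> lies in the image of \<open>V\<close> only if
      \<open>f = 0\<close> and \<open>x \<in> V\<close>, so openness of this complement gives room
      around \<open>y\<close>.\<close>
    have "(x, f) \<in> - (V \<times> {0})" using y x by auto
    moreover have "open (- (V \<times> {0 :: 'b}))" using V(2) by (simp add: closed_Times open_Compl)
    ultimately obtain e where e: "e > 0" "\<And>w. dist w (x, f) < e \<Longrightarrow> w \<in> - (V \<times> {0})"
      unfolding open_dist by blast
    show "\<exists>e>0. \<forall>y'. dist y' y < e \<longrightarrow> y' \<in> - (T ` V)"
    proof (intro exI conjI allI impI)
      show "e / c > 0" using e c by simp
      fix y' assume y': "dist y' y < e / c"
      obtain x' f' where z: "f' \<in> F" "T x' + f' = y' - y" "norm (x', f') \<le> c * norm (y' - y)"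
        using c(2)[of "y' - y"] by (auto simp: G_def)
      have "norm (x', f') < e"
        using z(3) y' c(1) by (simp add: dist_norm field_simps)
      then have "dist (x + x', f + f') (x, f) < e" by (simp add: dist_norm)
      then have nV: "(x + x', f + f') \<notin> V \<times> {0}" using e(2) by blast
      show "y' \<in> - (T ` V)"
      proof
        assume "y' \<in> T ` V"
        then obtain v where v: "v \<in> V" "y' = T v" by blast
        have "T (v - (x + x')) = T v - (T x + T x')"
          using clin.linear_diff[OF cl, of v "x + x'"] clin.linear_add[OF cl, of x x'] by simp
        also have "T v = (T x + f) + (T x' + f')" using z(2) v(2) x by simp
        finally have "T (v - (x + x')) = f + f'" by simp
        moreover have "f + f' \<in> F" using uf z FF(1) complex_vector.subspace_add by blast
        ultimately have "f + f' \<in> range T \<inter> F" by (metis IntI rangeI)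
        then have ff: "f + f' = 0" using direct_sumD(4)[OF F] by blast
        then have "v - (x + x') \<in> V"
          using \<open>T (v - (x + x')) = f + f'\<close> kerV by (auto simp: ker_def)
        then have "v - (v - (x + x')) \<in> V" using v V(1) complex_vector.subspace_diff by blast
        then show False using nV ff by (simp add: add.commute)
      qed
    qed
  qed
  then show ?thesis by (simp add: closed_def)
qed

section \<open>Ascent and descent\<close>

lemma asc_finite_iff: "asc T < \<infinity> \<longleftrightarrow> (\<exists>k. ker (T ^^ k) = ker (T ^^ Suc k))"
  unfolding asc_def Inf_less_iff by auto

lemma des_finite_iff: "des T < \<infinity> \<longleftrightarrow> (\<exists>k. range (T ^^ k) = range (T ^^ Suc k))"
  unfolding des_def Inf_less_iff by auto

lemma ker_funpow_Suc: "ker (T ^^ Suc n) = T -` ker (T ^^ n)" for T :: "'a::zero \<Rightarrow> 'a"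
  by (auto simp: ker_def funpow_Suc_right simp del: funpow.simps)

lemma range_funpow_Suc: "range (T ^^ Suc n) = T ` range (T ^^ n)" for T :: "'a \<Rightarrow> 'a"
  by (auto simp: image_image)

text \<open>Each kernel is the preimage under \<open>T\<close> of the preceding one, so one
  repetition forces all later ones.\<close>

lemma ker_funpow_stable:
  fixes T :: "'a::zero \<Rightarrow> 'a"
  assumes "ker (T ^^ k) = ker (T ^^ Suc k)" "k \<le> n"
  shows "ker (T ^^ n) = ker (T ^^ k)"
  using assms(2)
proof (induction n rule: dec_induct)
  case (step n)
  then show ?case using assms(1) by (metis ker_funpow_Suc)
qed simp

lemma range_funpow_stable:
  fixes T :: "'a \<Rightarrow> 'a"
  assumes "range (T ^^ k) = range (T ^^ Suc k)" "k \<le> n"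
  shows "range (T ^^ n) = range (T ^^ k)"
  using assms(2)
proof (induction n rule: dec_induct)
  case (step n)
  then show ?case using assms(1) by (metis range_funpow_Suc)
qed simp

lemma ker_funpow_stable_Suc:
  fixes T :: "'a::zero \<Rightarrow> 'a"
  assumes "ker (T ^^ k) = ker (T ^^ Suc k)" "k \<le> n"
  shows "ker (T ^^ n) = ker (T ^^ Suc n)"
  using ker_funpow_stable[OF assms] ker_funpow_stable[OF assms(1) le_SucI[OF assms(2)]]
  by (rule trans[OF _ sym])

lemma range_funpow_stable_Suc:
  fixes T :: "'a \<Rightarrow> 'a"
  assumes "range (T ^^ k) = range (T ^^ Suc k)" "k \<le> n"
  shows "range (T ^^ n) = range (T ^^ Suc n)"
  using range_funpow_stable[OF assms] range_funpow_stable[OF assms(1) le_SucI[OF assms(2)]]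
  by (rule trans[OF _ sym])

text \<open>Once both chains are known to stabilise, they are stable at exactly the same
  \<open>k\<close>, so the two infima are taken over the same set.\<close>

lemma asc_eq_des:
  assumes T: "clinear T" and fin: "asc T < \<infinity>" "des T < \<infinity>"
  shows "asc T = des T"
proof -
  obtain a where a: "ker (T ^^ a) = ker (T ^^ Suc a)" using fin(1) unfolding asc_finite_iff ..
  obtain d where d: "range (T ^^ d) = range (T ^^ Suc d)" using fin(2) unfolding des_finite_iff ..
  have "ker (T ^^ k) = ker (T ^^ Suc k) \<longleftrightarrow> range (T ^^ k) = range (T ^^ Suc k)" for k
  proof
    \<comment> \<open>At \<open>m\<close> the ranges are stable, so \<open>x\<close> can be compared
      with some \<open>T z\<close>; since \<open>m\<close> is at least \<open>k\<close>, the
      difference already lies in \<open>ker (T ^^ k)\<close>.\<close>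
    define m where "m = max d k"
    have m: "range (T ^^ m) = range (T ^^ Suc m)"
      by (rule range_funpow_stable_Suc[OF d]) (simp add: m_def)
    assume k: "ker (T ^^ k) = ker (T ^^ Suc k)"
    have "(T ^^ k) x \<in> range (T ^^ Suc k)" for x
    proof -
      obtain z where "(T ^^ m) x = (T ^^ Suc m) z" using m by (metis rangeE rangeI)
      then have "(T ^^ m) (x - T z) = 0"
        using clin.linear_diff[OF clinear_funpow[OF T]]
        by (simp add: funpow_Suc_right del: funpow.simps)
      then have "x - T z \<in> ker (T ^^ k)"
        using ker_funpow_stable[OF k, of m] by (auto simp: ker_def m_def)
      then have "(T ^^ k) x = (T ^^ Suc k) z"
        using clin.linear_diff[OF clinear_funpow[OF T]]
        by (simp add: ker_def funpow_Suc_right del: funpow.simps)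
      then show ?thesis by blast
    qed
    moreover have "range (T ^^ Suc k) \<subseteq> range (T ^^ k)"
      by (auto simp: funpow_Suc_right simp del: funpow.simps)
    ultimately show "range (T ^^ k) = range (T ^^ Suc k)" by blast
  next
    define m where "m = max a k"
    have m: "ker (T ^^ m) = ker (T ^^ Suc m)"
      by (rule ker_funpow_stable_Suc[OF a]) (simp add: m_def)
    assume k: "range (T ^^ k) = range (T ^^ Suc k)"
    have "(T ^^ k) x = 0" if x: "(T ^^ Suc k) x = 0" for x
    proof -
      obtain z where z: "(T ^^ k) x = (T ^^ m) z"
        using range_funpow_stable[OF k, of m] by (metis m_def max.cobounded2 rangeE rangeI)
      then have "(T ^^ Suc m) z = 0" using x by simp
      then have "(T ^^ m) z = 0" using m by (auto simp: ker_def simp del: funpow.simps)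
      then show ?thesis using z by simp
    qed
    moreover have "(T ^^ Suc k) x = 0" if "(T ^^ k) x = 0" for x
      using that clin.linear_0[OF T] by simp
    ultimately show "ker (T ^^ k) = ker (T ^^ Suc k)" unfolding ker_def by blast
  qed
  then show ?thesis by (simp add: asc_def des_def del: funpow.simps)
qed

section \<open>Finite nullity and defect of compositions and powers\<close>

lemma nullity_comp_finite:
  assumes "clinear T" "clinear S" "nullity T < \<infinity>" "nullity S < \<infinity>"
  shows "nullity (S \<circ> T) < \<infinity>"
proof -
  note c = composition_dimensions[OF assms(1,2)]
  have "cdimension (range T \<inter> ker S) \<le> nullity S" using c(3) by auto
  then have "cdimension (range T \<inter> ker S) < \<infinity>" using assms(4) by (rule order_le_less_trans)
  then show ?thesis unfolding c(1) using assms(3) by auto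
qed

lemma defect_comp_finite:
  assumes "clinear T" "clinear S" "defect T < \<infinity>" "defect S < \<infinity>"
  shows "defect (S \<circ> T) < \<infinity>"
proof -
  note c = composition_dimensions[OF assms(1,2)]
  have "codimension {r + n |r n. r \<in> range T \<and> n \<in> ker S} \<le> defect T"
    using c(3) by (auto simp: add.commute)
  then have "codimension {r + n |r n. r \<in> range T \<and> n \<in> ker S} < \<infinity>"
    using assms(3) by (rule order_le_less_trans)
  then show ?thesis unfolding c(2) using assms(4) by auto
qed

lemma nullity_injective_finite: "ker T = {0} \<Longrightarrow> nullity T < \<infinity>"
  unfolding nullity_def cdimension_finite_iff by (intro exI[of _ "{}"]) simp

lemma defect_surj: "range T = UNIV \<Longrightarrow> defect T < \<infinity>"
  using codimension_finite_iff[of UNIV] by (auto simp: defect_def)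

lemma nullity_funpow_finite:
  fixes T :: "'a::complex_vector \<Rightarrow> 'a"
  assumes "clinear T" "nullity T < \<infinity>" shows "nullity (T ^^ n) < \<infinity>"
proof (induction n)
  case 0
  have "ker (T ^^ 0) = {0}" by (auto simp: ker_def)
  then show ?case by (rule nullity_injective_finite)
next
  case (Suc n)
  then show ?case
    unfolding funpow.simps using assms clinear_funpow by (intro nullity_comp_finite)
qed

lemma defect_funpow_finite:
  fixes T :: "'a::complex_vector \<Rightarrow> 'a"
  assumes "clinear T" "defect T < \<infinity>" shows "defect (T ^^ n) < \<infinity>"
proof (induction n)
  case 0
  show ?case by (rule defect_surj) simp
next
  case (Suc n)
  then show ?case
    unfolding funpow.simps using assms clinear_funpow by (intro defect_comp_finite)
qed

text \<open>Beyond ascent and descent, \<open>T ^^ m \<circ> T\<close> and \<open>T ^^ m\<close>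
  have the same finite nullity and defect, which cancel in the index formula.\<close>

lemma browder_index:
  assumes "browder T" shows "nullity T = defect T"
proof -
  have T: "clinear T" "nullity T < \<infinity>" "defect T < \<infinity>" "asc T < \<infinity>" "des T < \<infinity>"
    using assms bounded_ops_clinear by (auto simp: browder_def fredholm_ops_def)
  obtain a where a: "ker (T ^^ a) = ker (T ^^ Suc a)" using T(4) unfolding asc_finite_iff ..
  obtain d where d: "range (T ^^ d) = range (T ^^ Suc d)" using T(5) unfolding des_finite_iff ..
  define m where "m = max a d"
  have "ker (T ^^ m) = ker (T ^^ Suc m)" "range (T ^^ m) = range (T ^^ Suc m)"
    by (rule ker_funpow_stable_Suc[OF a] range_funpow_stable_Suc[OF d], simp add: m_def)+
  then have "nullity (T ^^ m \<circ> T) = nullity (T ^^ m)" "defect (T ^^ m \<circ> T) = defect (T ^^ m)"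
    unfolding nullity_def defect_def funpow_Suc_right by simp_all
  then show ?thesis
    using index_composition[OF T(1) clinear_funpow[OF T(1)], of m]
      nullity_funpow_finite[OF T(1,2), of m] defect_funpow_finite[OF T(1,3), of m] T(2,3)
    by auto
qed

text \<open>The hypotheses say that \<open>M\<close> is nilpotent on \<open>V\<close> and on the
  quotient by \<open>W\<close>, both finite-dimensional, while \<open>inj\<close> and
  \<open>surj\<close> make the induced map on \<open>W\<close> modulo \<open>V\<close> bijective.
  Kernels and ranges are then stable from the power \<open>p + q\<close> on.\<close>

lemma browder_of_flag:
  fixes M :: "'a::complex_inner \<Rightarrow> 'a"
  assumes M: "M \<in> bounded_ops"
    and V: "csubspace V" "cdimension V < \<infinity>" "\<And>x. x \<in> V \<Longrightarrow> M x \<in> V"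
      "\<And>x. x \<in> V \<Longrightarrow> (M ^^ p) x = 0"
    and W: "csubspace W" "codimension W < \<infinity>" "\<And>x. x \<in> W \<Longrightarrow> M x \<in> W"
      "\<And>x. (M ^^ q) x \<in> W"
    and VW: "V \<subseteq> W" and inj: "\<And>x. x \<in> W \<Longrightarrow> M x \<in> V \<Longrightarrow> x \<in> V"
    and surj: "\<And>x. x \<in> W \<Longrightarrow> \<exists>y\<in>W. x - M y \<in> V"
  shows "browder M"
proof -
  have lin: "clinear M" using M by (rule bounded_ops_clinear)
  have linp: "clinear (M ^^ n)" for n using clinear_funpow[OF lin] .
  have inj_pow: "x \<in> V" if "x \<in> W" "(M ^^ n) x \<in> V" for n x
    using that
  proof (induction n arbitrary: x)
    case (Suc n)
    then have "M x \<in> V"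
      using W(3) by (simp add: funpow_Suc_right del: funpow.simps)
    then show ?case using inj Suc.prems by blast
  qed simp
  have surj_pow: "\<exists>y\<in>W. x - (M ^^ n) y \<in> V" if "x \<in> W" for n x
    using that
  proof (induction n arbitrary: x)
    case 0
    then show ?case using complex_vector.subspace_0[OF V(1)] by (intro bexI[of _ x]) auto
  next
    case (Suc n)
    obtain y where y: "y \<in> W" "x - M y \<in> V" using surj Suc.prems by blast
    obtain z where z: "z \<in> W" "y - (M ^^ n) z \<in> V" using Suc.IH[OF y(1)] by blast
    have "(x - M y) + M (y - (M ^^ n) z) \<in> V"
      using y z V(3) complex_vector.subspace_add[OF V(1)] by blast
    moreover have "(x - M y) + M (y - (M ^^ n) z) = x - (M ^^ Suc n) z"
      using clin.linear_diff[OF lin] by simp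
    ultimately show ?case using z by (intro bexI[of _ z]) simp_all
  qed
  \<comment> \<open>The first \<open>q\<close> factors move \<open>x\<close> into \<open>W\<close>;
    injectivity modulo \<open>V\<close> puts the result into \<open>V\<close>, where
    \<open>p\<close> further factors annihilate it.\<close>
  have "(M ^^ (p + q)) x = 0" if "(M ^^ Suc (p + q)) x = 0" for x
  proof -
    have "(M ^^ Suc p) ((M ^^ q) x) = 0" using that by (simp add: funpow_add)
    then have "(M ^^ q) x \<in> V"
      using inj_pow[OF W(4), of "Suc p"] complex_vector.subspace_0[OF V(1)] by metis
    then show ?thesis using V(4) by (simp add: funpow_add)
  qed
  moreover have "(M ^^ Suc (p + q)) x = 0" if "(M ^^ (p + q)) x = 0" for x
    using that clin.linear_0[OF lin] by simp
  ultimately have "ker (M ^^ (p + q)) = ker (M ^^ Suc (p + q))"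
    unfolding ker_def by blast
  then have asc: "asc M < \<infinity>" unfolding asc_finite_iff ..
  \<comment> \<open>Dually, surjectivity modulo \<open>V\<close> solves for
    \<open>(M ^^ q) x\<close> up to an error in \<open>V\<close>, which \<open>M ^^ p\<close>
    kills.\<close>
  have "(M ^^ (p + q)) x \<in> range (M ^^ Suc (p + q))" for x
  proof -
    obtain y where y: "(M ^^ q) x - (M ^^ Suc q) y \<in> V" using surj_pow[OF W(4)] by blast
    have "(M ^^ p) ((M ^^ q) x) = (M ^^ p) ((M ^^ Suc q) y)"
      using V(4)[OF y] clin.linear_diff[OF linp] by simp
    then have "(M ^^ (p + q)) x = (M ^^ (p + Suc q)) y" unfolding funpow_add comp_apply .
    then have "(M ^^ (p + q)) x = (M ^^ Suc (p + q)) y" by (simp only: add_Suc_right)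
    then show ?thesis by blast
  qed
  moreover have "range (M ^^ Suc (p + q)) \<subseteq> range (M ^^ (p + q))"
    by (auto simp: funpow_Suc_right simp del: funpow.simps)
  ultimately have "range (M ^^ (p + q)) = range (M ^^ Suc (p + q))" by blast
  then have des: "des M < \<infinity>" unfolding des_finite_iff ..
  have kerM: "csubspace (ker M)" using csubspace_ker[OF lin] .
  have "ker M \<inter> W \<subseteq> V"
    using inj complex_vector.subspace_0[OF V(1)] by (auto simp: ker_def)
  then have "cdimension (ker M \<inter> W) \<le> cdimension V"
    using kerM V(1) W(1) by (intro cdimension_mono complex_vector.subspace_inter)
  then have "nullity M < \<infinity>"
    unfolding nullity_def using V(2)
    by (intro cdimension_finite_of_codimension[OF kerM W(1,2)]) (rule order_le_less_trans)
  moreover have "defect M < \<infinity>"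
  proof -
    obtain B where B: "finite B" "cspan B = V" using V(2) cdimension_finiteD by blast
    obtain F where F: "finite F" "\<And>x. \<exists>y\<in>cspan F. x - y \<in> W"
      using W(1,2) codimension_finite_iff by blast
    \<comment> \<open>\<open>F\<close> corrects \<open>x\<close> into \<open>W\<close>, and
      \<open>B\<close> absorbs the remaining error in \<open>V\<close>.\<close>
    have "\<exists>y\<in>cspan (B \<union> F). x - y \<in> range M" for x
    proof -
      obtain y where y: "y \<in> cspan F" "x - y \<in> W" using F by blast
      obtain z where z: "x - y - M z \<in> V" using surj[OF y(2)] by blast
      have "y + (x - y - M z) \<in> cspan (B \<union> F)"
        using y z B(2) complex_vector.span_mono[of B "B \<union> F"] complex_vector.span_mono[of F "B \<union> F"]
        by (intro complex_vector.span_add) auto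
      moreover have "x - (y + (x - y - M z)) = M z" by simp
      ultimately show ?thesis by (metis rangeI)
    qed
    then show ?thesis
      unfolding defect_def codimension_finite_iff[OF csubspace_range[OF lin]]
      using B(1) F(1) by (intro exI[of _ "B \<union> F"]) simp
  qed
  ultimately show ?thesis
    using M asc des asc_eq_des[OF lin] by (simp add: browder_def fredholm_ops_def)
qed

section \<open>Block triangular operators\<close>

lemma bounded_ops_comp:
  assumes "S \<in> bounded_ops" "T \<in> bounded_ops" shows "S \<circ> T \<in> bounded_ops"
  using assms bounded_linear_compose[of S T] by (auto simp: bounded_ops_def comp_def)

lemma bounded_ops_funpow: "T \<in> bounded_ops \<Longrightarrow> T ^^ n \<in> bounded_ops"
  for T :: "'a::complex_inner \<Rightarrow> 'a"
proof (induction n)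
  case 0
  then show ?case by (simp add: bounded_ops_def id_def bounded_linear_ident)
next
  case (Suc n)
  then show ?case unfolding funpow.simps by (intro bounded_ops_comp)
qed

lemma shift_op_bounded: "T \<in> bounded_ops \<Longrightarrow> shift_op T l \<in> bounded_ops"
  using bounded_linear_sub[of T "\<lambda>x. l *\<^sub>C x"] bounded_linear_scaleC[of l]
  by (auto simp: bounded_ops_def shift_op_def complex_vector.scale_right_diff_distrib
      scaleC_scaleC mult.commute)

lemma shift_op_block: "shift_op (block_op A B C) l = block_op (shift_op A l) (shift_op B l) C"
  by (auto simp: fun_eq_iff shift_op_def block_op_def scaleC_prod_def)

lemma block_op_bounded:
  assumes "A \<in> bounded_ops" "B \<in> bounded_ops" "C \<in> bounded_ops"
  shows "block_op A B C \<in> bounded_ops"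
proof -
  have bl: "bounded_linear A" "bounded_linear B" "bounded_linear C"
    using assms by (auto simp: bounded_ops_def)
  have "bounded_linear (\<lambda>z. (A (fst z) + C (snd z), B (snd z)))"
    by (intro bounded_linear_Pair bounded_linear_add bounded_linear_compose[OF bl(1)]
        bounded_linear_compose[OF bl(2)] bounded_linear_compose[OF bl(3)]
        bounded_linear_fst bounded_linear_snd)
  moreover have "block_op A B C = (\<lambda>z. (A (fst z) + C (snd z), B (snd z)))"
    by (auto simp: block_op_def)
  ultimately show ?thesis
    using assms by (auto simp: bounded_ops_def scaleC_prod_def scaleC_add_right)
qed

lemma csubspace_Times: "csubspace V \<Longrightarrow> csubspace W \<Longrightarrow> csubspace (V \<times> W)"
  by (auto simp: complex_vector.subspace_def scaleC_prod_def zero_prod_def)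

lemma cdimension_Times_0: "csubspace V \<Longrightarrow> cdimension (V \<times> {0}) = cdimension V"
proof -
  assume V: "csubspace V"
  have "clinear (\<lambda>x. (x, 0))" by (simp add: clinear_iff scaleC_prod_def)
  moreover have "ker (\<lambda>x. (x, 0)) \<inter> V = {0}"
    using complex_vector.subspace_0[OF V] by (auto simp: ker_def zero_prod_def)
  moreover have "(\<lambda>x. (x, 0)) ` V = V \<times> {0}" by auto
  ultimately show ?thesis using cdimension_inj_image V by metis
qed

lemma cdimension_0_Times: "csubspace V \<Longrightarrow> cdimension ({0} \<times> V) = cdimension V"
proof -
  assume V: "csubspace V"
  have "clinear (\<lambda>x. (0, x))" by (simp add: clinear_iff scaleC_prod_def)
  moreover have "ker (\<lambda>x. (0, x)) \<inter> V = {0}"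
    using complex_vector.subspace_0[OF V] by (auto simp: ker_def zero_prod_def)
  moreover have "(\<lambda>x. (0, x)) ` V = {0} \<times> V" by auto
  ultimately show ?thesis using cdimension_inj_image V by metis
qed

lemma codimension_Times_UNIV:
  fixes V :: "'a::complex_vector set"
  assumes V: "csubspace V"
  shows "codimension (V \<times> (UNIV :: 'b::complex_vector set)) = codimension V"
proof -
  obtain W where W: "direct_sum V W UNIV" using direct_sum_complement[OF V] ..
  note D = direct_sumD[OF W]
  have "direct_sum (V \<times> (UNIV :: 'b set)) (W \<times> {0}) UNIV"
    unfolding direct_sum_def
  proof (intro conjI csubspace_Times V D(2) complex_vector.subspace_UNIV
      complex_vector.subspace_single_0)
    show "(V \<times> (UNIV :: 'b set)) \<inter> (W \<times> {0}) = {0}" using D(4) by (auto simp: zero_prod_def)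
    have "\<exists>u w. z = u + w \<and> u \<in> V \<times> UNIV \<and> w \<in> W \<times> {0}" for z :: "'a \<times> 'b"
    proof -
      obtain u w where "u \<in> V" "w \<in> W" "fst z = u + w"
        using direct_sum_decompose[OF W UNIV_I] .
      then show ?thesis
        by (intro exI[of _ "(u, snd z)"] exI[of _ "(w, 0)"]) (auto simp: prod_eq_iff)
    qed
    then show "UNIV = {u + w |u w. u \<in> V \<times> UNIV \<and> w \<in> W \<times> {0 :: 'b}}" by auto
  qed
  then show ?thesis
    using codimension_eq_cdimension[OF W] codimension_eq_cdimension cdimension_Times_0[OF D(2)]
    by metis
qed

lemma codimension_UNIV_Times:
  fixes V :: "'a::complex_vector set"
  assumes V: "csubspace V"
  shows "codimension ((UNIV :: 'b::complex_vector set) \<times> V) = codimension V"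
proof -
  obtain W where W: "direct_sum V W UNIV" using direct_sum_complement[OF V] ..
  note D = direct_sumD[OF W]
  have "direct_sum ((UNIV :: 'b set) \<times> V) ({0} \<times> W) UNIV"
    unfolding direct_sum_def
  proof (intro conjI csubspace_Times V D(2) complex_vector.subspace_UNIV
      complex_vector.subspace_single_0)
    show "((UNIV :: 'b set) \<times> V) \<inter> ({0} \<times> W) = {0}" using D(4) by (auto simp: zero_prod_def)
    have "\<exists>u w. z = u + w \<and> u \<in> UNIV \<times> V \<and> w \<in> {0} \<times> W" for z :: "'b \<times> 'a"
    proof -
      obtain u w where "u \<in> V" "w \<in> W" "snd z = u + w"
        using direct_sum_decompose[OF W UNIV_I] .
      then show ?thesis
        by (intro exI[of _ "(fst z, u)"] exI[of _ "(0, w)"]) (auto simp: prod_eq_iff)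
    qed
    then show "UNIV = {u + w |u w. u \<in> UNIV \<times> V \<and> w \<in> {0 :: 'b} \<times> W}" by auto
  qed
  then show ?thesis
    using codimension_eq_cdimension[OF W] codimension_eq_cdimension cdimension_0_Times[OF D(2)]
    by metis
qed

section \<open>Kernels, ranges and powers of block operators\<close>

lemma block_op_funpow_inl:
  assumes "clinear A" "clinear B" "clinear C"
  shows "(block_op A B C ^^ n) (x, 0) = ((A ^^ n) x, 0)"
  by (induction n) (simp_all add: block_op_def clin.linear_0[OF assms(2)] clin.linear_0[OF assms(3)])

lemma snd_block_op_funpow: "snd ((block_op A B C ^^ n) z) = (B ^^ n) (snd z)"
  by (induction n) (simp_all add: block_op_def split_beta)

text \<open>In the factorisation \<open>S \<circ> T\<close>, the factor \<open>T\<close> has the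
  nullity and defect of \<open>A\<close>, and \<open>S\<close> has those of
  \<open>B\<close>.\<close>

lemma block_op_dimensions:
  assumes A: "clinear A" and B: "clinear B" and C: "clinear C"
  shows "nullity A + nullity B + defect (block_op A B C) =
      nullity (block_op A B C) + defect A + defect B"
    and "nullity A \<le> nullity (block_op A B C)"
    and "defect B \<le> defect (block_op A B C)"
proof -
  define T where "T = (\<lambda>(x, y). (A x, y :: 'b))"
  define S where "S = (\<lambda>(x, y). (x + C y, B y))"
  have T: "clinear T"
    using A by (auto simp: clinear_iff T_def scaleC_prod_def)
  have S: "clinear S"
    using B C by (auto simp: clinear_iff S_def scaleC_prod_def scaleC_add_right)
  have ST: "block_op A B C = S \<circ> T" by (auto simp: block_op_def S_def T_def)
  have "ker T = ker A \<times> {0}" by (auto simp: ker_def T_def zero_prod_def)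
  then have nT: "nullity T = nullity A"
    using cdimension_Times_0[OF csubspace_ker[OF A]] by (simp add: nullity_def)
  have "range T = range A \<times> UNIV" by (auto simp: T_def image_iff)
  then have dT: "defect T = defect A"
    using codimension_Times_UNIV[OF csubspace_range[OF A]] by (simp add: defect_def)
  have "\<exists>a b. (x, B y) = (a + C b, B b)" for x y by (intro exI[of _ "x - C y"] exI[of _ y]) simp
  then have "range S = UNIV \<times> range B" by (auto simp: S_def image_iff)
  then have dS: "defect S = defect B"
    using codimension_UNIV_Times[OF csubspace_range[OF B]] by (simp add: defect_def)
  \<comment> \<open>\<open>ker S\<close> is the graph of \<open>- C\<close> over
    \<open>ker B\<close>, so \<open>J\<close> identifies it with \<open>ker B\<close>.\<close>
  define J where "J = (\<lambda>y. (- C y, y))"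
  have J: "clinear J" using C by (auto simp: clinear_iff J_def scaleC_prod_def)
  have "ker S = J ` ker B"
    by (auto simp: ker_def S_def J_def zero_prod_def image_iff eq_neg_iff_add_eq_0)
  moreover have "ker J \<inter> ker B = {0}"
    using clin.linear_0[OF C] clin.linear_0[OF B] by (auto simp: ker_def J_def zero_prod_def)
  ultimately have nS: "nullity S = nullity B"
    using cdimension_inj_image[OF J csubspace_ker[OF B]] by (simp add: nullity_def)
  show "nullity A + nullity B + defect (block_op A B C) =
      nullity (block_op A B C) + defect A + defect B"
    using index_composition[OF T S] by (simp add: ST nT dT nS dS)
  show "nullity A \<le> nullity (block_op A B C)" "defect B \<le> defect (block_op A B C)"
    using composition_dimensions(1,2)[OF T S] by (simp_all add: ST nT dS)
qed

text \<open>\<open>A\<close> is the restriction of the block operator to an invariant subspace and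
  \<open>B\<close> is the induced quotient map, so \<open>A\<close> inherits the finite ascent and
  \<open>B\<close> the finite descent.\<close>

lemma browder_block_imp:
  fixes A :: "'h::chilbert_space \<Rightarrow> 'h" and B :: "'k::chilbert_space \<Rightarrow> 'k"
  assumes ops: "A \<in> bounded_ops" "B \<in> bounded_ops" "C \<in> bounded_ops"
    and br: "browder (block_op A B C)"
  shows "left_semi_browder A" "right_semi_browder B"
    "nullity A + nullity B = defect A + defect B"
proof -
  define M where "M = block_op A B C"
  have A: "clinear A" and B: "clinear B" and C: "clinear C"
    using ops bounded_ops_clinear by auto
  have M: "M \<in> bounded_ops" "nullity M < \<infinity>" "defect M < \<infinity>" "asc M < \<infinity>" "des M < \<infinity>"
    using br by (auto simp: browder_def fredholm_ops_def M_def)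
  have linM: "clinear M" using M(1) by (rule bounded_ops_clinear)
  note dims = block_op_dimensions[OF A B C, folded M_def]
  have "nullity M = defect M" using browder_index br by (simp add: M_def)
  then show "nullity A + nullity B = defect A + defect B"
    using dims(1) M(3) by (auto simp: add.assoc add.commute)
  have nA: "nullity A < \<infinity>" using dims(2) M(2) by (rule order_le_less_trans)
  have dB: "defect B < \<infinity>" using dims(3) M(3) by (rule order_le_less_trans)
  have "closed (range A)"
  proof -
    obtain G where G: "finite G" "cspan G = ker M"
      using M(2) cdimension_finiteD unfolding nullity_def by blast
    \<comment> \<open>Adding the finite-dimensional kernel keeps the first summand closed and leaves
      its image under \<open>M\<close> unchanged, while providing
      \<open>ker M \<subseteq> V\<close>.\<close>
    define V where "V = {u + v |u v. u \<in> (UNIV \<times> {0} :: ('h \<times> 'k) set) \<and> v \<in> cspan G}"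
    have H: "orthocomplemented (UNIV \<times> {0} :: ('h \<times> 'k) set)"
      unfolding orthocomplemented_def
    proof (intro conjI csubspace_Times complex_vector.subspace_UNIV
        complex_vector.subspace_single_0 allI)
      fix z :: "'h \<times> 'k"
      show "\<exists>v\<in>UNIV \<times> {0}. z - v \<in> orth (UNIV \<times> {0})"
        by (intro bexI[of _ "(fst z, 0)"])
          (auto simp: orth_def cinner_prod_def cinner_0_left cinner_0_right)
    qed
    have V: "orthocomplemented V"
      unfolding V_def by (rule orthocomplemented_add_finite[OF H G(1)])
    have "ker M \<subseteq> V"
      unfolding V_def G(2)[symmetric]
      by (force intro: exI[of _ 0] simp: zero_prod_def)
    then have cl: "closed (M ` V)"
      using closed_image_finite_defect[OF M(1,3)] V closed_orthocomplemented[OF V]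
      by (auto simp: orthocomplemented_def)
    have "(x, 0) \<in> M ` V \<longleftrightarrow> x \<in> range A" for x
    proof
      assume "(x, 0) \<in> M ` V"
      then obtain a v where "(x, 0) = M ((a, 0) + v)" "v \<in> ker M"
        unfolding V_def G(2) by auto
      then have "(x, 0) = M (a, 0)" using clin.linear_add[OF linM] by (simp add: ker_def)
      then show "x \<in> range A" using clin.linear_0[OF C] by (simp add: M_def block_op_def)
    next
      assume "x \<in> range A"
      then obtain a where "x = A a" by blast
      then have "(x, 0) = M (a, 0)"
        using clin.linear_0[OF C] clin.linear_0[OF B] by (simp add: M_def block_op_def)
      moreover have "(a, 0) \<in> V"
      proof -
        have "(a, 0) = (a, 0) + (0 :: 'h \<times> 'k)" by simp
        then show ?thesis unfolding V_def using complex_vector.span_zero by blast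
      qed
      ultimately show "(x, 0) \<in> M ` V" by blast
    qed
    then have "range A = (\<lambda>x. (x, 0)) -` (M ` V)" by blast
    moreover have "continuous_on UNIV (\<lambda>x::'h. (x, 0 :: 'k))" by (intro continuous_intros)
    ultimately show ?thesis using closed_vimage[OF cl] by simp
  qed
  moreover have "complemented (range A)"
    using complemented_if_orthocomplemented orthocomplemented_closed[OF csubspace_range[OF A]]
      calculation by blast
  moreover have "asc A < \<infinity>"
  proof -
    obtain k where k: "ker (M ^^ k) = ker (M ^^ Suc k)" using M(4) unfolding asc_finite_iff ..
    have "x \<in> ker (A ^^ n) \<longleftrightarrow> (x, 0) \<in> ker (M ^^ n)" for x n
      using block_op_funpow_inl[OF A B C, of n x] by (simp add: ker_def M_def zero_prod_def)
    then have "ker (A ^^ k) = ker (A ^^ Suc k)" using k by blast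
    then show ?thesis unfolding asc_finite_iff ..
  qed
  ultimately show "left_semi_browder A"
    using ops(1) nA by (simp add: left_semi_browder_def left_semi_fredholm_def)
  have "closed (ker B)"
  proof -
    have "ker B = B -` {0}" by (auto simp: ker_def)
    moreover have "continuous_on UNIV B"
      using ops(2) linear_continuous_on by (auto simp: bounded_ops_def)
    ultimately show ?thesis using closed_vimage[of "{0}" B] by simp
  qed
  moreover have "complemented (ker B)"
    using complemented_if_orthocomplemented orthocomplemented_closed[OF csubspace_ker[OF B]]
      calculation by blast
  moreover have "des B < \<infinity>"
  proof -
    obtain k where k: "range (M ^^ k) = range (M ^^ Suc k)" using M(5) unfolding des_finite_iff ..
    have "range (B ^^ n) = snd ` range (M ^^ n)" for n
    proof -
      have "(B ^^ n) y = snd ((M ^^ n) (0, y))" for y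
        by (simp add: M_def snd_block_op_funpow)
      then have "range (B ^^ n) \<subseteq> snd ` range (M ^^ n)" by blast
      then show ?thesis by (auto simp: M_def snd_block_op_funpow)
    qed
    then have "range (B ^^ k) = range (B ^^ Suc k)" using k by metis
    then show ?thesis unfolding des_finite_iff ..
  qed
  ultimately show "right_semi_browder B"
    using ops(2) dB by (simp add: right_semi_browder_def right_semi_fredholm_def)
qed

text \<open>\<open>T\<close> has the same range on \<open>orth N\<close> as on the whole space; if
  \<open>orth N\<close> were finite-dimensional, so would be the range and, by the finite defect,
  the space.\<close>

lemma cdimension_orth_infinite:
  assumes inf: "cdimension (UNIV :: 'a::complex_inner set) = \<infinity>"
    and T: "clinear (T :: 'a \<Rightarrow> 'a)" and fin: "defect T < \<infinity>"
    and N: "orthocomplemented N" "N \<subseteq> ker T"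
  shows "cdimension (orth N) = \<infinity>"
proof (rule ccontr)
  assume "\<not> ?thesis"
  moreover have "T ` UNIV = T ` orth N"
  proof -
    have "T x \<in> T ` orth N" for x
    proof -
      obtain n where n: "n \<in> N" "x - n \<in> orth N" using N(1) by (auto simp: orthocomplemented_def)
      then have "T x = T (x - n)" using clin.linear_diff[OF T] N(2) by (auto simp: ker_def)
      then show ?thesis using n by blast
    qed
    then show ?thesis by blast
  qed
  ultimately have "cdimension (range T) \<noteq> \<infinity>"
    using rank_nullity[OF T csubspace_orth[of N]] by (cases "cdimension (T ` orth N)") auto
  moreover obtain W where W: "direct_sum (range T) W UNIV"
    using direct_sum_complement[OF csubspace_range[OF T]] ..
  ultimately show False
    using cdimension_direct_sum[OF W] codimension_eq_cdimension[OF W] fin inf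
    by (auto simp: defect_def)
qed

lemma browder_block_exists:
  fixes A :: "'h::chilbert_space \<Rightarrow> 'h" and B :: "'k::chilbert_space \<Rightarrow> 'k"
  assumes sep: "separable (UNIV :: 'h set)" "separable (UNIV :: 'k set)"
    and inf: "cdimension (UNIV :: 'h set) = \<infinity>" "cdimension (UNIV :: 'k set) = \<infinity>"
    and LA: "left_semi_browder A" and RB: "right_semi_browder B"
    and index: "nullity A + nullity B = defect A + defect B"
  shows "\<exists>C\<in>invertible_ops. browder (block_op A B C)"
proof -
  have A: "A \<in> bounded_ops" "closed (range A)" "nullity A < \<infinity>" "asc A < \<infinity>"
    using LA by (auto simp: left_semi_browder_def left_semi_fredholm_def)
  have B: "B \<in> bounded_ops" "closed (ker B)" "defect B < \<infinity>" "des B < \<infinity>"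
    using RB by (auto simp: right_semi_browder_def right_semi_fredholm_def)
  have lA: "clinear A" and lB: "clinear B" using A B bounded_ops_clinear by auto
  obtain p where p: "ker (A ^^ p) = ker (A ^^ Suc p)" using A(4) unfolding asc_finite_iff ..
  obtain q where q: "range (B ^^ q) = range (B ^^ Suc q)" using B(4) unfolding des_finite_iff ..
  define N where "N = ker (A ^^ p)"
  define K where "K = range (B ^^ q)"
  define L where "L = K \<inter> ker B"
  define R where "R = {r + n |r n. r \<in> range A \<and> n \<in> N}"
  have lAp: "clinear (A ^^ p)" and lBq: "clinear (B ^^ q)" using lA lB clinear_funpow by auto
  have sN: "csubspace N" and sK: "csubspace K"
    unfolding N_def K_def by (rule csubspace_ker[OF lAp] csubspace_range[OF lBq])+
  have finN: "cdimension N < \<infinity>"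
    using nullity_funpow_finite[OF lA A(3), of p] by (simp add: N_def nullity_def)
  have finK: "codimension K < \<infinity>"
    using defect_funpow_finite[OF lB B(3), of q] by (simp add: K_def defect_def)
  have AN: "x \<in> N \<longleftrightarrow> A x \<in> N" for x
    using p ker_funpow_Suc[of p A] by (auto simp: N_def)
  have BK: "B ` K = K" using q range_funpow_Suc[of q B] by (simp add: K_def)
  \<comment> \<open>In the composition \<open>A ^^ p \<circ> A\<close> the nullity does not grow
    beyond that of \<open>A ^^ p\<close>. Cancelling the finite dimension of
    \<open>range A \<inter> N\<close> gives \<open>b = nullity A\<close>.\<close>
  have codim_R: "defect A = nullity A + codimension R"
  proof -
    note D = composition_dimensions[OF lA lAp]
    have "nullity (A ^^ p \<circ> A) = nullity (A ^^ p)"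
      unfolding nullity_def funpow_Suc_right[symmetric] by (simp only: p)
    then show ?thesis
      using D(1,3) finN by (auto simp: nullity_def N_def R_def add.commute)
  qed
  \<comment> \<open>Dually, \<open>B \<circ> B ^^ q\<close> has the defect of \<open>B ^^ q\<close>,
    and cancelling the finite codimension term gives \<open>b = defect B\<close>.\<close>
  have dim_L: "nullity B = cdimension L + defect B"
  proof -
    note D = composition_dimensions[OF lBq lB]
    have "defect (B \<circ> B ^^ q) = defect (B ^^ q)"
      unfolding defect_def funpow.simps(2)[symmetric] by (simp only: q)
    then show ?thesis
      using D(2,3) finK by (auto simp: defect_def K_def L_def add.commute)
  qed
  have dims: "cdimension L = codimension R"
    using index codim_R dim_L A(3) B(3) by (auto simp: add.assoc add.commute add.left_commute)
  obtain G where G: "finite G" "cspan G = N" using finN cdimension_finiteD by blast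
  have oR: "orthocomplemented R"
    using orthocomplemented_add_finite[OF orthocomplemented_closed[OF csubspace_range[OF lA] A(2)] G(1)]
    by (simp add: R_def G(2))
  have "closed K"
    using closed_image_finite_defect[OF bounded_ops_funpow[OF B(1)], of q UNIV] finK
    by (simp add: K_def defect_def)
  then have oL: "orthocomplemented L"
    unfolding L_def using sK csubspace_ker[OF lB] B(2)
    by (intro orthocomplemented_closed complex_vector.subspace_inter closed_Int)
  have "cdimension (orth L) = \<infinity>"
    using cdimension_orth_infinite[OF inf(2) lB B(3) oL] by (simp add: L_def)
  \<comment> \<open>This double complement is \<open>R\<close>, which contains the range of
    \<open>A\<close>; that range is infinite-dimensional because \<open>A\<close> has finite
    nullity.\<close>
  moreover have "cdimension (orth (orth R)) = \<infinity>"
  proof -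
    have "cdimension (range A) = \<infinity>"
      using rank_nullity[OF lA complex_vector.subspace_UNIV] inf(1) A(3)
      by (cases "cdimension (range A)") (auto simp: nullity_def)
    moreover have "range A \<subseteq> R"
      unfolding R_def using complex_vector.subspace_0[OF sN] by force
    ultimately show ?thesis
      unfolding orth_orth[OF oR]
      using cdimension_mono[OF csubspace_range[OF lA], of R] oR by (simp add: orthocomplemented_def)
  qed
  moreover have "cdimension L = cdimension (orth R)"
    unfolding dims by (rule codimension_eq_cdimension[OF direct_sum_orth[OF oR]])
  ultimately obtain C where C: "C \<in> invertible_ops" "C ` L = orth R"
    using invertible_op_subspace_onto[OF sep(2,1) oL orthocomplemented_orth[OF oR]] by blast
  have Cb: "C \<in> bounded_ops" using C(1) by (simp add: invertible_ops_def)
  have lC: "clinear C" using Cb by (rule bounded_ops_clinear)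
  obtain D where "D \<circ> C = id" using C(1) by (auto simp: invertible_ops_def)
  then have D: "D (C y) = y" for y by (simp add: fun_eq_iff)
  have Cinj: "y = 0" if "C y = 0" for y
    using D[of y] D[of 0] unfolding that clin.linear_0[OF lC] by simp
  define M where "M = block_op A B C"
  note R_orth = direct_sumD(4)[OF direct_sum_orth[OF oR]]
  have "browder M"
  proof (rule browder_of_flag[where V = "N \<times> {0}" and W = "UNIV \<times> K" and p = p and q = q])
    show "M \<in> bounded_ops" unfolding M_def by (rule block_op_bounded[OF A(1) B(1) Cb])
    show "csubspace (N \<times> {0 :: 'k})" 
      by (rule csubspace_Times[OF sN complex_vector.subspace_single_0])
    show "cdimension (N \<times> {0 :: 'k}) < \<infinity>" 
      unfolding cdimension_Times_0[OF sN] by (rule finN)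
    show "csubspace ((UNIV :: 'h set) \<times> K)" 
      by (rule csubspace_Times[OF complex_vector.subspace_UNIV sK])
    show "codimension ((UNIV :: 'h set) \<times> K) < \<infinity>" 
      unfolding codimension_UNIV_Times[OF sK] by (rule finK)
    show "N \<times> {0} \<subseteq> UNIV \<times> K" using complex_vector.subspace_0[OF sK] by auto
    show "M z \<in> N \<times> {0}" if "z \<in> N \<times> {0}" for z
      using that iffD1[OF AN] clin.linear_0[OF lB] clin.linear_0[OF lC]
      by (auto simp: M_def block_op_def)
    show "(M ^^ p) z = 0" if "z \<in> N \<times> {0}" for z
      using that block_op_funpow_inl[OF lA lB lC] by (auto simp: M_def N_def ker_def zero_prod_def)
    show "M z \<in> UNIV \<times> K" if "z \<in> UNIV \<times> K" for z
      using that equalityD1[OF BK] by (auto simp: M_def block_op_def)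
    show "(M ^^ q) z \<in> UNIV \<times> K" for z
      using snd_block_op_funpow[where n = q and z = z] by (simp add: M_def K_def mem_Times_iff)
    \<comment> \<open>The second component forces \<open>y \<in> L\<close>, so
      \<open>C y \<in> orth R\<close>; the first gives \<open>C y \<in> R\<close>. Hence
      \<open>C y = 0\<close>, and \<open>x \<in> N\<close> remains.\<close>
    show "z \<in> N \<times> {0}" if z: "z \<in> UNIV \<times> K" "M z \<in> N \<times> {0}" for z
    proof -
      obtain x y where xy: "z = (x, y)" by (cases z)
      have *: "y \<in> L" "A x + C y \<in> N"
        using z by (auto simp: xy M_def block_op_def L_def ker_def)
      have "C y \<in> orth R" using *(1) C(2) by blast
      moreover have "C y \<in> R"
      proof -
        have "A (- x) + (A x + C y) \<in> R" unfolding R_def using *(2) by blast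
        then show ?thesis by (simp add: clin.linear_neg[OF lA])
      qed
      ultimately have "C y = 0" using R_orth by blast
      then have "y = 0" using Cinj by blast
      then show ?thesis using *(2) \<open>C y = 0\<close> iffD2[OF AN[of x]] by (simp add: xy)
    qed
    \<comment> \<open>First \<open>B y = k\<close> is solved within \<open>K\<close>. A correction
      \<open>l \<in> L\<close> removes the \<open>orth R\<close> part of \<open>h - C y\<close>
      without changing the second component, and the \<open>R\<close> part is \<open>A x\<close> up
      to \<open>N\<close>.\<close>
    show "\<exists>w\<in>UNIV \<times> K. z - M w \<in> N \<times> {0}" if z: "z \<in> UNIV \<times> K" for z
    proof -
      obtain h k where hk: "z = (h, k)" "k \<in> K" using z by auto
      have "k \<in> B ` K" using hk(2) BK by simp
      then obtain y where y: "y \<in> K" "B y = k" by blast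
      obtain r d where rd: "r \<in> R" "d \<in> orth R" "h - C y = r + d"
        using direct_sum_decompose[OF direct_sum_orth[OF oR] UNIV_I] .
      obtain x n where xn: "n \<in> N" "r = A x + n" using rd(1) by (auto simp: R_def)
      have "d \<in> C ` L" using rd(2) C(2) by simp
      then obtain l where l: "l \<in> L" "C l = d" by blast
      have "z - M (x, y + l) = (n, 0)"
        using rd(3) xn l y clin.linear_add[OF lC] clin.linear_add[OF lB]
        by (simp add: hk M_def block_op_def L_def ker_def algebra_simps)
      moreover have "y + l \<in> K"
        using y l sK complex_vector.subspace_add by (auto simp: L_def)
      ultimately show ?thesis using xn(1) by (intro bexI[of _ "(x, y + l)"]) auto
    qed
  qed
  then show ?thesis using C(1) by (auto simp: M_def)
qed

section \<open>Assembly of the spectral identity\<close>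

lemma invertible_ops_fredholm: "invertible_ops \<subseteq> fredholm_ops"
proof
  fix T :: "'a::complex_inner \<Rightarrow> 'b::complex_inner"
  assume T: "T \<in> invertible_ops"
  then obtain S where S: "S \<circ> T = id" "T \<circ> S = id" and Tb: "T \<in> bounded_ops"
    by (auto simp: invertible_ops_def)
  have ST: "S (T x) = x" "T (S y) = y" for x y
    using S by (auto simp: fun_eq_iff)
  have "T 0 = 0" using clin.linear_0[OF bounded_ops_clinear[OF Tb]] .
  have "ker T \<subseteq> {0}"
  proof
    fix x assume "x \<in> ker T"
    then have "S (T x) = S (T 0)" using \<open>T 0 = 0\<close> by (simp add: ker_def)
    then show "x \<in> {0}" unfolding ST by simp
  qed
  then have "ker T = {0}" using \<open>T 0 = 0\<close> by (auto simp: ker_def)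
  moreover have "range T = UNIV" using ST(2) by (metis surjI)
  ultimately show "T \<in> fredholm_ops"
    using Tb nullity_injective_finite defect_surj by (auto simp: fredholm_ops_def)
qed

theorem theorem2p15:
  fixes A :: "'h::chilbert_space \<Rightarrow> 'h" and B :: "'k::chilbert_space \<Rightarrow> 'k"
  assumes "separable (UNIV :: 'h set)" and "cdimension (UNIV :: 'h set) = \<infinity>"
    and "separable (UNIV :: 'k set)" and "cdimension (UNIV :: 'k set) = \<infinity>"
    and "A \<in> bounded_ops" and "B \<in> bounded_ops"
  shows "(\<Inter>C\<in>(invertible_ops :: ('k \<Rightarrow> 'h) set). browder_spectrum (block_op A B C)) =
      (\<Inter>C\<in>(fredholm_ops :: ('k \<Rightarrow> 'h) set). browder_spectrum (block_op A B C)) \<and>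
    (\<Inter>C\<in>(fredholm_ops :: ('k \<Rightarrow> 'h) set). browder_spectrum (block_op A B C)) =
      left_semi_browder_spectrum A \<union> right_semi_browder_spectrum B \<union>
      {l. nullity (shift_op A l) + nullity (shift_op B l) \<noteq>
          defect (shift_op A l) + defect (shift_op B l)}"
    (is "?G = ?F \<and> ?F = ?S")
proof -
  \<comment> \<open>The inclusions \<open>FG\<close>, \<open>SF\<close> and \<open>GS\<close> form a
    cycle, which yields both equalities.\<close>
  have FG: "?F \<subseteq> ?G" by (rule INF_superset_mono[OF invertible_ops_fredholm]) simp
  have SF: "?S \<subseteq> ?F"
  proof (intro subsetI INT_I)
    fix l and C :: "'k \<Rightarrow> 'h" assume l: "l \<in> ?S" and C: "C \<in> fredholm_ops"
    have ops: "shift_op A l \<in> bounded_ops" "shift_op B l \<in> bounded_ops" "C \<in> bounded_ops"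
      using assms(5,6) C shift_op_bounded by (auto simp: fredholm_ops_def)
    show "l \<in> browder_spectrum (block_op A B C)"
      using l browder_block_imp[OF ops]
      by (auto simp: browder_spectrum_def shift_op_block left_semi_browder_spectrum_def
          right_semi_browder_spectrum_def)
  qed
  have GS: "?G \<subseteq> ?S"
  proof (rule subsetI, rule ccontr)
    fix l assume G: "l \<in> ?G" and S: "l \<notin> ?S"
    obtain C :: "'k \<Rightarrow> 'h" where "C \<in> invertible_ops"
      "browder (block_op (shift_op A l) (shift_op B l) C)"
      using browder_block_exists[OF assms(1,3,2,4), of "shift_op A l" "shift_op B l"] S
      by (auto simp: left_semi_browder_spectrum_def right_semi_browder_spectrum_def)
    then show False using G by (auto simp: browder_spectrum_def shift_op_block)
  qed
  show ?thesis
    by (intro conjI subset_antisym FG SF order_trans[OF GS SF] order_trans[OF FG GS])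
qed

end
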